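(* Let $F:\mathbb{R}^2\times\mathbb{R}^2\to\mathbb{R}$ satisfy, for all $p,q,q_1,q_2$: $F$ is continuous; $F(p,\cdot)$ is convex; $F(p,\lambda q)=\lambda F(p,q)$ for $\lambda>0$; $m_1|q|\le F(p,q)\le m_2|q|$ for some $m_1,m_2>0$. Suppose there exists a continuous $F_\infty:\mathbb{R}^2\times\mathbb{R}^2\to\mathbb{R}$ with $F_\infty(p+n,q)=F_\infty(p,q)$ for all $n\in\mathbb{Z}^2$, and such that for every $q\in\mathbb{R}^2$, $F(p,q)-F_\infty(p,q)\to0$ as $|p|\to+\infty$. Then for every $\tau\in\mathbb{R}$, $S_F(\tau)\le S_{F_\infty}(\tau)$. Moreover, if for a fixed $\tau\in\mathbb{R}$ one has $S_F(\tau)<S_{F_\infty}(\tau)$, then there exists a Lipschitz continuous $u_\tau\in\mathcal{M}_\tau$ with $\mathcal{F}(u_\tau)=S_F(\tau)$.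
   Context: $W^{1,1}$ is the space of $1$-periodic maps in $W^{1,1}_{loc}(\mathbb{R};\mathbb{R}^2)$. For a Lagrangian $G$, $\mathcal{G}(u)=\int_0^1G(u,\dot u)\,dt$; $\mathcal{A}(u)=\frac12\int_0^1u\cdot i\dot u\,dt$ with $ip$ the rotation of $p$ by $\pi/2$; $\mathcal{M}_\tau=\{u\in W^{1,1}:\mathcal{A}(u)=\tau\}$ and $S_G(\tau)=\inf_{\mathcal{M}_\tau}\mathcal{G}$. In particular $\mathcal{F}$ and $S_F$, $S_{F_\infty}$ are defined this way. *)

theory Defs
  imports "HOL-Analysis.Analysis"
begin

text \<open>The plane R^2 is modelled by the complex numbers; the rotation by pi/2 is
  multiplication by the imaginary unit, and the dot product is the real inner product.\<close>

text \<open>W^{1,1}: 1-periodic maps in W^{1,1}_loc(R;R^2), i.e. 1-periodic maps that are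
  locally absolutely continuous (primitive of a locally integrable function).\<close>
definition W11 :: "(real \<Rightarrow> complex) set" where
  "W11 = {u. (\<forall>t. u (t + 1) = u t) \<and>
     (\<exists>v. (\<forall>a b. v absolutely_integrable_on {a..b}) \<and>
          (\<forall>a b. a \<le> b \<longrightarrow> u b - u a = integral {a..b} v))}"

text \<open>The functional associated with a Lagrangian G; the derivative is the a.e. derivative.\<close>
definition Lagr :: "(complex \<Rightarrow> complex \<Rightarrow> real) \<Rightarrow> (real \<Rightarrow> complex) \<Rightarrow> real" where
  "Lagr G u = integral {0..1} (\<lambda>t. G (u t) (vector_derivative u (at t)))"

definition area :: "(real \<Rightarrow> complex) \<Rightarrow> real" where
  "area u = 1/2 * integral {0..1} (\<lambda>t. u t \<bullet> (\<i> * vector_derivative u (at t)))"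

definition Mset :: "real \<Rightarrow> (real \<Rightarrow> complex) set" where
  "Mset \<tau> = {u \<in> W11. area u = \<tau>}"

definition Sval :: "(complex \<Rightarrow> complex \<Rightarrow> real) \<Rightarrow> real \<Rightarrow> real" where
  "Sval G \<tau> = Inf (Lagr G ` Mset \<tau>)"

end

theory Submission
  imports Defs "HOL-Complex_Analysis.Great_Picard"
begin

text \<open>Translating a competitor for \<open>Finf\<close> by large integer vectors gives competitors for \<open>F\<close> with
  almost the same energy, hence \<open>Sval F \<tau> \<le> Sval Finf \<tau>\<close>. For existence, homogeneity allows one to
  reparametrize a minimizing sequence so that it is uniformly Lipschitz. If its curves went off to
  infinity, their \<open>F\<close>- and \<open>Finf\<close>-energies would become equal, contradicting the strict inequality;
  so they stay in a bounded set, a subsequence converges uniformly, the area passes to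
  the limit and the energy is lower semicontinuous because \<open>F p\<close> is sublinear.\<close>

section \<open>Primitives of locally integrable functions and Lipschitz functions\<close>

text \<open>The energy does not see the parametrization, so a bound on it controls only the length
  of a curve (\<open>m1\<close> times the length is at most the energy). A minimizing sequence may
  squeeze its motion into ever shorter time intervals, and linear growth gives no weak compactness
  of derivatives in L1. Hence curves are reparametrized before any limit is taken. Even then only
  the curves converge, uniformly; nothing is known about convergence of their derivatives. The area
  copes with this by integration by parts along closed curves. The energy copes by replacing
  derivatives with difference quotients of a fixed step h: the curves converge first, and h tends to
  0 afterwards.

  Membership in \<open>W11\<close> asks for a density of which the curve is a primitive, while
  reparametrized curves and their uniform limits are only known to be Lipschitz. Bridging this is
  the purpose of the Radon-Nikodym argument below.\<close>

lemma primitive_has_derivative_ae: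
  fixes v P :: "real \<Rightarrow> 'b::euclidean_space"
  assumes int: "\<And>a b. v integrable_on {a..b}"
    and P: "\<And>a b. a \<le> b \<Longrightarrow> P b - P a = integral {a..b} v"
  obtains N where "negligible N" "\<And>t. t \<notin> N \<Longrightarrow> (P has_vector_derivative v t) (at t)"
proof -
  obtain N1 where N1: "negligible N1" "\<And>x e. \<lbrakk>x \<notin> N1; 0 < e\<rbrakk> \<Longrightarrow>
      \<exists>d>0. \<forall>h. 0 < h \<and> h < d \<longrightarrow> norm (integral {x..x+h} v /\<^sub>R h - v x) < e"
    using integrable_ccontinuous_explicit[of v] int by (auto simp: cbox_interval)
  \<comment> \<open>\<open>integrable_ccontinuous_explicit\<close> controls averages to the right of
    a point. Applied to the reflected function it controls averages to the left, and the two
    together give a two-sided derivative.\<close>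
  have "(\<lambda>x. v (- x)) integrable_on {a..b}" for a b
    using Henstock_Kurzweil_Integration.integrable_reflect_real[where f=v and a="-b" and b="-a"] int by simp
  then obtain N2 where N2: "negligible N2" "\<And>x e. \<lbrakk>x \<notin> N2; 0 < e\<rbrakk> \<Longrightarrow>
      \<exists>d>0. \<forall>h. 0 < h \<and> h < d \<longrightarrow> norm (integral {x..x+h} (\<lambda>x. v (-x)) /\<^sub>R h - v (-x)) < e"
    using integrable_ccontinuous_explicit[of "\<lambda>x. v (-x)"] by (auto simp: cbox_interval)
  let ?N = "N1 \<union> uminus ` N2"
  have "negligible ?N"
    using N1 N2 by (intro negligible_Un negligible_differentiable_image_negligible) (auto intro!: derivative_intros simp: differentiable_on_def)
  moreover have "(P has_vector_derivative v t) (at t)" if t: "t \<notin> ?N" for t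
    unfolding has_vector_derivative_def has_derivative_at_alt
  proof (intro conjI allI impI)
    show "bounded_linear (\<lambda>x. x *\<^sub>R v t)" by (rule bounded_linear_scaleR_left)
    fix e :: real assume e: "0 < e"
    have "t \<notin> N1" "- t \<notin> N2" using t by force+
    from N1(2)[OF this(1) e] N2(2)[OF this(2) e] obtain d1 d2 where
      d1: "d1 > 0" "\<And>h. 0 < h \<Longrightarrow> h < d1 \<Longrightarrow> norm (integral {t..t+h} v /\<^sub>R h - v t) < e" and
      d2: "d2 > 0" "\<And>h. 0 < h \<Longrightarrow> h < d2 \<Longrightarrow> norm (integral {-t..-t+h} (\<lambda>x. v (-x)) /\<^sub>R h - v t) < e"
      by auto
    show "\<exists>d>0. \<forall>y. norm (y - t) < d \<longrightarrow> norm (P y - P t - (y - t) *\<^sub>R v t) \<le> e * norm (y - t)"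
    proof (intro exI[of _ "min d1 d2"] conjI allI impI)
      show "0 < min d1 d2" using d1 d2 by simp
      fix y assume y: "norm (y - t) < min d1 d2"
      consider "y = t" | "y > t" | "y < t" by linarith
      then show "norm (P y - P t - (y - t) *\<^sub>R v t) \<le> e * norm (y - t)"
      proof cases
        case 2
        have "P y - P t - (y - t) *\<^sub>R v t = (y - t) *\<^sub>R (integral {t..t+(y-t)} v /\<^sub>R (y-t) - v t)"
          using 2 P[of t y] by (simp add: scaleR_diff_right)
        then show ?thesis using d1(2)[of "y-t"] 2 y
          by (simp add: mult.commute mult_left_mono less_imp_le)
      next
        case 3
        have *: "integral {-t..-t+(t-y)} (\<lambda>x. v (-x)) = P t - P y"
          using 3 P[of y t] Henstock_Kurzweil_Integration.integral_reflect_real[where f=v and a=y and b=t] by simp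
        have "P y - P t - (y - t) *\<^sub>R v t =
          (y - t) *\<^sub>R (integral {-t..-t+(t-y)} (\<lambda>x. v (-x)) /\<^sub>R (t-y) - v t)"
        proof -
          have "(y-t) *\<^sub>R ((P t - P y) /\<^sub>R (t-y)) = ((y-t) * inverse (t-y)) *\<^sub>R (P t - P y)" by simp
          also have "(y-t) * inverse (t-y) = -1" using 3 by (simp add: field_simps)
          finally show ?thesis unfolding * by (simp add: scaleR_diff_right)
        qed
        then show ?thesis using d2(2)[of "t-y"] 3 y
          by (simp add: mult.commute mult_left_mono less_imp_le)
      qed simp
    qed
  qed
  ultimately show ?thesis using that by blast
qed

lemma ex_primitive:
  fixes v :: "real \<Rightarrow> 'b::banach"
  assumes int: "\<And>a b. v integrable_on {a..b}"
  obtains P where "\<And>a b. a \<le> b \<Longrightarrow> P b - P a = integral {a..b} v"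
proof -
  \<comment> \<open>This is the signed integral from 0 to \<open>t\<close>: one of the two intervals
    is always empty or a single point.\<close>
  define P where "P t = integral {0..t} v - integral {t..0} v" for t
  have c: "integral {a..b} v + integral {b..c} v = integral {a..c} v" if "a \<le> b" "b \<le> c" for a b c
    using Henstock_Kurzweil_Integration.integral_combine[OF that int] .
  have "P b - P a = integral {a..b} v" if "a \<le> b" for a b
  proof -
    consider "0 \<le> a" | "b \<le> 0" | "a < 0" "0 < b" by linarith
    then show ?thesis
    proof cases
      case 1
      then have "integral {a..0} v = 0" "integral {b..0} v = 0" using that
        by (cases "a = 0"; cases "b = 0"; simp)+
      then show ?thesis using c[of 0 a b] 1 that by (simp add: P_def algebra_simps)
    next
      case 2
      then have "integral {0..a} v = 0" "integral {0..b} v = 0" using that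
        by (cases "a = 0"; cases "b = 0"; simp)+
      then show ?thesis using c[of a b 0] 2 that by (simp add: P_def algebra_simps)
    next
      case 3
      then show ?thesis using c[of a 0 b] by (simp add: P_def algebra_simps)
    qed
  qed
  then show ?thesis using that by blast
qed

text \<open>Open intervals are the boxes on which \<open>lborel_eqI\<close> compares a measure with
  Lebesgue measure.\<close>

lemma emeasure_interval_measure_Ioo:
  assumes "a \<le> b" "\<And>x y. x \<le> y \<Longrightarrow> F x \<le> F y" "continuous_on UNIV F"
  shows "emeasure (interval_measure F) {a<..<b} = ennreal (F b - F a)"
proof (cases "a = b")
  case False
  have rc: "continuous (at_right x) F" for x
    using assms(3) by (auto intro: continuous_within_subset simp: continuous_on_eq_continuous_within)
  have "{a<..<b} = {a<..b} - {b}" using assms(1) by auto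
  also have "emeasure (interval_measure F) \<dots> = emeasure (interval_measure F) {a<..b} - emeasure (interval_measure F) {b}"
    using emeasure_interval_measure_Icc[of b b F] assms False by (intro emeasure_Diff) auto
  also have "\<dots> = ennreal (F b - F a)"
    using emeasure_interval_measure_Icc[of b b F] emeasure_interval_measure_Ioc[of a b F] assms rc by simp
  finally show ?thesis .
qed (use assms in simp)

text \<open>The measures with distribution functions \<open>f\<close> and \<open>id - f\<close> add up to Lebesgue measure, so the
  first one has a density.\<close>
lemma monotone_nonexpansive_imp_primitive:
  fixes f :: "real \<Rightarrow> real"
  assumes mono: "\<And>x y. x \<le> y \<Longrightarrow> f x \<le> f y"
    and nonexp: "\<And>x y. x \<le> y \<Longrightarrow> f y - f x \<le> y - x"
  obtains g where "\<And>a b. g absolutely_integrable_on {a..b}" "\<And>a b. a \<le> b \<Longrightarrow> f b - f a = integral {a..b} g"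
proof -
  have "\<bar>f x - f y\<bar> \<le> 1 * \<bar>x - y\<bar>" for x y
    using mono[of x y] mono[of y x] nonexp[of x y] nonexp[of y x] by (cases "x \<le> y") auto
  then have "1-lipschitz_on UNIV f" by (intro lipschitz_onI) (auto simp: dist_real_def)
  then have cont: "continuous_on UNIV f" by (rule lipschitz_on_continuous_on)
  let ?\<mu> = "interval_measure f" and ?\<kappa> = "interval_measure (\<lambda>x. x - f x)"
  define S where "S = measure_of UNIV (sets borel) (\<lambda>A. emeasure ?\<mu> A + emeasure ?\<kappa> A)"
  have sigma: "sigma_algebra UNIV (sets (borel :: real measure))"
    using sets.sigma_algebra_axioms[of borel] by simp
  have setsS: "sets S = sets borel" unfolding S_def
    by (metis sets.sigma_sets_eq sets.space_closed sets_measure_of space_borel)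
  have emS: "emeasure S A = emeasure ?\<mu> A + emeasure ?\<kappa> A" if "A \<in> sets borel" for A
    unfolding S_def
  proof (rule emeasure_measure_of_sigma[OF sigma _ _ that])
    show "positive (sets borel) (\<lambda>A. emeasure ?\<mu> A + emeasure ?\<kappa> A)"
      by (simp add: positive_def)
    show "countably_additive (sets borel) (\<lambda>A. emeasure ?\<mu> A + emeasure ?\<kappa> A)"
    proof (rule countably_additiveI)
      fix A :: "nat \<Rightarrow> real set" assume A: "range A \<subseteq> sets borel" "disjoint_family A"
      show "(\<Sum>i. emeasure ?\<mu> (A i) + emeasure ?\<kappa> (A i)) = emeasure ?\<mu> (\<Union> (range A)) + emeasure ?\<kappa> (\<Union> (range A))"
        using A by (subst suminf_add[symmetric]) (auto simp: suminf_emeasure)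
    qed
  qed
  have S: "lborel = S"
  proof (rule lborel_eqI)
    fix l u :: real assume "\<And>b. b \<in> Basis \<Longrightarrow> l \<bullet> b \<le> u \<bullet> b"
    then have lu: "l \<le> u" by simp
    have "emeasure S {l<..<u} = ennreal (f u - f l) + ennreal ((u - f u) - (l - f l))"
      unfolding emS[OF borel_open[OF open_greaterThanLessThan]]
      using lu mono nonexp cont
      by (intro arg_cong2[of _ _ _ _ "(+)"] emeasure_interval_measure_Ioo continuous_intros)
         (auto simp: algebra_simps)
    also have "\<dots> = ennreal (u - l)"
      using lu mono[of l u] nonexp[of l u] by (subst ennreal_plus[symmetric]) auto
    finally show "emeasure S (box l u) = ennreal (\<Prod>b\<in>Basis. (u - l) \<bullet> b)"
      by (simp add: box_real)
  qed (rule setsS)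
  \<comment> \<open>The Lebesgue measure of a Borel set is the sum of its two measures, so a
    Lebesgue null set is null for each of them.\<close>
  have "absolutely_continuous lborel ?\<mu>"
    unfolding absolutely_continuous_def null_sets_def
    using emS by (auto simp: S setsS)
  from sigma_finite_measure.Radon_Nikodym[OF sigma_finite_lborel this] obtain h where h: "h \<in> borel_measurable borel" "density lborel h = ?\<mu>"
    by (auto simp: measurable_lborel1)
  have fin: "(\<integral>\<^sup>+x. h x * indicator {a..b} x \<partial>lborel) = ennreal (f b - f a)" if "a \<le> b" for a b
    using emeasure_interval_measure_Icc[OF that, of f] mono cont h
    by (metis atLeastAtMost_borel emeasure_density measurable_lborel2 sets_lborel)
  let ?g = "\<lambda>x. enn2real (h x)"
  \<comment> \<open>The density \<open>h\<close> is extended-valued, and \<open>enn2real\<close>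
    would send the value \<infinity> to 0. Finiteness of the integral over each [-n, n] excludes
    that value almost everywhere.\<close>
  have "AE x in lborel. h x \<noteq> \<infinity>"
  proof -
    have "AE x in lborel. x \<in> {- real n..real n} \<longrightarrow> h x \<noteq> \<infinity>" for n
    proof -
      have "AE x in lborel. h x * indicator {- real n..real n} x \<noteq> \<infinity>"
        using h fin[of "- real n" "real n"] by (intro nn_integral_PInf_AE) auto
      then show ?thesis by (rule AE_mp) auto
    qed
    then have "AE x in lborel. \<forall>n. x \<in> {- real n..real n} \<longrightarrow> h x \<noteq> \<infinity>"
      by (subst AE_all_countable) (rule allI)
    then show ?thesis
    proof (rule AE_mp, intro AE_I2 impI)
      fix x :: real assume *: "\<forall>n. x \<in> {- real n..real n} \<longrightarrow> h x \<noteq> \<infinity>"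
      obtain n :: nat where "\<bar>x\<bar> \<le> real n" using real_arch_simple by blast
      then show "h x \<noteq> \<infinity>" using *[rule_format, of n] by (auto simp: abs_le_iff)
    qed
  qed
  then have hg: "AE x in lborel. h x = ennreal (?g x)"
    by (rule AE_mp) (auto simp: top.not_eq_extremum)
  have I: "(?g has_integral (f b - f a)) {a..b}" if "a \<le> b" for a b
  proof -
    have "(\<integral>\<^sup>+x. ennreal (indicator {a..b} x * ?g x) \<partial>lborel) = (\<integral>\<^sup>+x. h x * indicator {a..b} x \<partial>lborel)"
      using hg by (intro nn_integral_cong_AE, elim AE_mp) (auto split: split_indicator intro!: AE_I2)
    also have "\<dots> = ennreal (f b - f a)" by (rule fin[OF that])
    finally have "((\<lambda>x. indicator {a..b} x * ?g x) has_integral (f b - f a)) UNIV"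
      using h mono[OF that] by (intro nn_integral_has_integral) auto
    moreover have "(\<lambda>x. indicator {a..b} x * ?g x) = (\<lambda>x. if x \<in> {a..b} then ?g x else 0)"
      by (auto split: split_indicator)
    ultimately show ?thesis by (metis has_integral_restrict_UNIV)
  qed
  show thesis
  proof (rule that)
    show "f b - f a = integral {a..b} ?g" if "a \<le> b" for a b using I[OF that] by (simp add: integral_unique)
    show "?g absolutely_integrable_on {a..b}" for a b
    proof (cases "a \<le> b")
      case True
      then show ?thesis using I[OF True] by (intro nonnegative_absolutely_integrable_1) auto
    qed simp
  qed
qed

text \<open>Dividing by \<open>K = 2 * (L + 1)\<close> brings the slopes of \<open>f\<close> into
  [-1/2, 1/2], and adding x/2 brings them into [0, 1]. The result \<open>p\<close> is monotone and
  nonexpansive, and its density \<open>g\<close> gives back K (g - 1/2) as density of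
  \<open>f\<close>. The summand 1 keeps \<open>K\<close> positive when \<open>L\<close> is
  0.\<close>

lemma lipschitz_imp_primitive_real:
  fixes f :: "real \<Rightarrow> real"
  assumes "L-lipschitz_on UNIV f"
  obtains g where "\<And>a b. g absolutely_integrable_on {a..b}" "\<And>a b. a \<le> b \<Longrightarrow> f b - f a = integral {a..b} g"
proof -
  define K where "K = 2 * (L + 1)"
  have L: "0 \<le> L" using assms lipschitz_on_nonneg by blast
  then have K: "K > 0" by (simp add: K_def)
  have fL: "\<bar>f y - f x\<bar> \<le> L * (y - x)" if "x \<le> y" for x y
    using lipschitz_onD[OF assms, of y x] that by (simp add: dist_real_def)
  have LK: "2 * (L * (y - x)) \<le> K * (y - x)" if "x \<le> y" for x y :: real
    using that by (simp add: K_def algebra_simps)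
  define p where "p x = x / 2 + f x / K" for x
  have p: "\<bar>(p y - p x) - (y - x) / 2\<bar> \<le> (y - x) / 2" if "x \<le> y" for x y
  proof -
    have "(p y - p x) - (y - x) / 2 = (f y - f x) / K" by (simp add: p_def add_divide_distrib diff_divide_distrib)
    also have "\<bar>\<dots>\<bar> = \<bar>f y - f x\<bar> / K" using K by simp
    also have "\<dots> \<le> (y - x) / 2" using fL[OF that] LK[OF that] K by (simp add: field_simps)
    finally show ?thesis .
  qed
  obtain g where g: "\<And>a b. g absolutely_integrable_on {a..b}" "\<And>a b. a \<le> b \<Longrightarrow> p b - p a = integral {a..b} g"
  proof (rule monotone_nonexpansive_imp_primitive[of p])
    show "p x \<le> p y" if "x \<le> y" for x y using p[OF that] by (simp add: abs_le_iff field_simps)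
    show "p y - p x \<le> y - x" if "x \<le> y" for x y using p[OF that] by (simp add: abs_le_iff field_simps)
  qed blast
  show thesis
  proof (rule that[of "\<lambda>x. K *\<^sub>R (g x - 1/2)"])
    show "(\<lambda>x. K *\<^sub>R (g x - 1/2)) absolutely_integrable_on {a..b}" for a b
      using g by (intro absolutely_integrable_scaleR_left set_integral_diff) auto
    show "f b - f a = integral {a..b} (\<lambda>x. K *\<^sub>R (g x - 1/2))" if "a \<le> b" for a b
    proof -
      have "integral {a..b} (\<lambda>x. K *\<^sub>R (g x - 1/2)) = K * (integral {a..b} g - integral {a..b} (\<lambda>x. 1/2))"
        using g(1)[of a b] by (simp add: integral_diff set_lebesgue_integral_eq_integral(1))
      also have "\<dots> = K * ((f b - f a) / K)" using that g(2)[OF that, symmetric]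
        by (simp add: p_def add_divide_distrib diff_divide_distrib)
      also have "\<dots> = f b - f a" using K by simp
      finally show ?thesis by simp
    qed
  qed
qed

lemma lipschitz_imp_primitive:
  fixes f :: "real \<Rightarrow> complex"
  assumes "L-lipschitz_on UNIV f"
  obtains g where "\<And>a b. g absolutely_integrable_on {a..b}" "\<And>a b. a \<le> b \<Longrightarrow> f b - f a = integral {a..b} g"
proof -
  have f: "norm (f x - f y) \<le> L * \<bar>x - y\<bar>" for x y
    using lipschitz_onD[OF assms, of x y] by (simp add: dist_norm dist_real_def)
  have L: "0 \<le> L" using assms lipschitz_on_nonneg by blast
  have "L-lipschitz_on UNIV (\<lambda>x. Re (f x))" "L-lipschitz_on UNIV (\<lambda>x. Im (f x))"
    using order_trans[OF abs_Re_le_cmod f] order_trans[OF abs_Im_le_cmod f] L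
    by (auto intro!: lipschitz_onI simp: dist_real_def)
  then obtain g h where g: "\<And>a b. g absolutely_integrable_on {a..b}" "\<And>a b. a \<le> b \<Longrightarrow> Re (f b) - Re (f a) = integral {a..b} g"
    and h: "\<And>a b. h absolutely_integrable_on {a..b}" "\<And>a b. a \<le> b \<Longrightarrow> Im (f b) - Im (f a) = integral {a..b} h"
    by (metis lipschitz_imp_primitive_real)
  have gi: "g integrable_on {a..b}" "h integrable_on {a..b}" for a b
    using g(1) h(1) set_lebesgue_integral_eq_integral(1) by blast+
  show thesis
  proof (rule that[of "\<lambda>x. complex_of_real (g x) + \<i> * complex_of_real (h x)"])
    show "(\<lambda>x. complex_of_real (g x) + \<i> * complex_of_real (h x)) absolutely_integrable_on {a..b}" for a b
      using g(1)[of a b] h(1)[of a b]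
      by (subst absolutely_integrable_componentwise_iff) (simp add: Basis_complex_def)
    fix a b :: real assume ab: "a \<le> b"
    have "((\<lambda>x. complex_of_real (g x) + \<i> * complex_of_real (h x)) has_integral
      (complex_of_real (integral {a..b} g) + \<i> * complex_of_real (integral {a..b} h))) {a..b}"
      using gi[of a b] by (intro has_integral_add has_integral_mult_right has_integral_of_real integrable_integral)
    then show "f b - f a = integral {a..b} (\<lambda>x. complex_of_real (g x) + \<i> * complex_of_real (h x))"
      using g(2)[OF ab] h(2)[OF ab] by (simp add: integral_unique complex_eq_iff)
  qed
qed

section \<open>Locally absolutely continuous maps\<close>

abbreviation vderiv :: "(real \<Rightarrow> complex) \<Rightarrow> real \<Rightarrow> complex" where
  "vderiv u t \<equiv> vector_derivative u (at t)"

definition loc_abs_cont :: "(real \<Rightarrow> complex) \<Rightarrow> bool" where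
  "loc_abs_cont u \<longleftrightarrow> (\<exists>v. (\<forall>a b. v absolutely_integrable_on {a..b}) \<and> (\<forall>a b. a \<le> b \<longrightarrow> u b - u a = integral {a..b} v))"

lemma W11_iff: "u \<in> W11 \<longleftrightarrow> (\<forall>t. u (t + 1) = u t) \<and> loc_abs_cont u"
  by (simp add: W11_def loc_abs_cont_def)

lemma loc_abs_cont_lipschitz: "L-lipschitz_on UNIV u \<Longrightarrow> loc_abs_cont u"
  unfolding loc_abs_cont_def by (metis lipschitz_imp_primitive)

text \<open>Off a null set \<open>vderiv u\<close> equals the density \<open>v\<close> hidden in the
  definition, so later integrals can be written with the derivative itself. On the null set
  \<open>vderiv u\<close> may be arbitrary, which integrals do not notice.\<close>

lemma loc_abs_contD:
  assumes "loc_abs_cont u"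
  shows "vderiv u absolutely_integrable_on {a..b}"
    and "a \<le> b \<Longrightarrow> (vderiv u has_integral (u b - u a)) {a..b}"
    and "\<exists>N. negligible N \<and> (\<forall>t. t \<notin> N \<longrightarrow> (u has_vector_derivative vderiv u t) (at t))"
    and "continuous_on UNIV u"
proof -
  obtain v where v: "\<And>a b. v absolutely_integrable_on {a..b}" "\<And>a b. a \<le> b \<Longrightarrow> u b - u a = integral {a..b} v"
    using assms by (auto simp: loc_abs_cont_def)
  have vi: "v integrable_on {a..b}" for a b
    using v(1) set_lebesgue_integral_eq_integral(1) by blast
  obtain N where N: "negligible N" "\<And>t. t \<notin> N \<Longrightarrow> (u has_vector_derivative v t) (at t)"
    using primitive_has_derivative_ae[OF vi v(2)] by blast
  have eq: "vderiv u t = v t" if "t \<notin> N" for t using N(2)[OF that] by (rule vector_derivative_at)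
  show "vderiv u absolutely_integrable_on {a..b}"
    using absolutely_integrable_spike[OF v(1) N(1)] eq by simp
  show "(vderiv u has_integral (u b - u a)) {a..b}" if "a \<le> b"
    using has_integral_spike[OF N(1), of "{a..b}" "vderiv u" v "u b - u a"] eq v(2)[OF that] vi[of a b]
    by (simp add: integrable_integral)
  show "\<exists>N. negligible N \<and> (\<forall>t. t \<notin> N \<longrightarrow> (u has_vector_derivative vderiv u t) (at t))"
    using N eq by auto
  have "continuous_on {-r..r} u" for r
  proof (cases "-r \<le> r")
    case True
    have "continuous_on {-r..r} (\<lambda>x. u (-r) + integral {-r..x} v)"
      by (intro continuous_intros indefinite_integral_continuous_1 vi)
    moreover have "u (-r) + integral {-r..x} v = u x" if "x \<in> {-r..r}" for x
      using v(2)[of "-r" x, symmetric] that by simp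
    ultimately show ?thesis by (rule continuous_on_eq)
  qed simp
  then have "continuous_on {-r<..<r} u" for r
    by (rule continuous_on_subset[of "{-r..r}"]) auto
  then have "isCont u x" for x
  proof -
    have "continuous_on {-(\<bar>x\<bar>+1)<..<\<bar>x\<bar>+1} u" using \<open>\<And>r. continuous_on {-r<..<r} u\<close> .
    moreover have "x \<in> {-(\<bar>x\<bar>+1)<..<\<bar>x\<bar>+1}" by auto
    ultimately show ?thesis by (simp add: continuous_on_eq_continuous_at)
  qed
  then show "continuous_on UNIV u" by (simp add: continuous_at_imp_continuous_on)
qed

lemma vderiv_integrable: "loc_abs_cont u \<Longrightarrow> vderiv u integrable_on {a..b}"
  using loc_abs_contD(1) set_lebesgue_integral_eq_integral(1) by blast

lemma norm_vderiv_integrable: "loc_abs_cont u \<Longrightarrow> (\<lambda>t. norm (vderiv u t)) integrable_on {a..b}"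
  using loc_abs_contD(1) unfolding absolutely_integrable_on_def by blast

lemma difference_quotient_tendsto:
  assumes "(u has_vector_derivative D) (at t)"
  shows "((\<lambda>h. (u (t + h) - u t) /\<^sub>R h) \<longlongrightarrow> D) (at (0::real))"
proof -
  have "((\<lambda>h. norm (u (t + h) - u t - h *\<^sub>R D) / norm h) \<longlongrightarrow> 0) (at 0)"
    using assms by (simp add: has_vector_derivative_def has_derivative_at)
  moreover have "\<forall>\<^sub>F h in at (0::real). norm (u (t + h) - u t - h *\<^sub>R D) / norm h = norm ((u (t + h) - u t) /\<^sub>R h - D)"
    unfolding eventually_at_filter
  proof (intro always_eventually allI impI)
    fix h :: real assume "h \<noteq> 0"
    then have "(u (t + h) - u t) /\<^sub>R h - D = (u (t + h) - u t - h *\<^sub>R D) /\<^sub>R h"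
      by (simp add: scaleR_diff_right)
    then show "norm (u (t + h) - u t - h *\<^sub>R D) / norm h = norm ((u (t + h) - u t) /\<^sub>R h - D)"
      by (simp add: divide_inverse mult.commute)
  qed
  ultimately have "((\<lambda>h. norm ((u (t + h) - u t) /\<^sub>R h - D)) \<longlongrightarrow> 0) (at 0)"
    by (simp cong: tendsto_cong)
  then show ?thesis by (simp add: tendsto_norm_zero_iff LIM_zero_iff)
qed

lemma norm_difference_quotient_le:
  assumes "L-lipschitz_on UNIV u"
  shows "norm ((u (t + h) - u t) /\<^sub>R h) \<le> L"
proof (cases "h = 0")
  case False
  have "norm (u (t + h) - u t) \<le> L * \<bar>h\<bar>"
    using lipschitz_onD[OF assms, of "t + h" t] by (simp add: dist_norm)
  then show ?thesis using False
    unfolding norm_scaleR by (simp add: divide_simps mult.commute)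
qed (use assms lipschitz_on_nonneg in auto)

lemma norm_vderiv_le_lipschitz:
  assumes "L-lipschitz_on UNIV u" "(u has_vector_derivative vderiv u t) (at t)"
  shows "norm (vderiv u t) \<le> L"
  using Lim_norm_ubound[OF _ difference_quotient_tendsto[OF assms(2)]] norm_difference_quotient_le[OF assms(1)]
  by simp

text \<open>The growth bound is asked only along \<open>u\<close> and only on the given interval. In
  this form it also covers the area integrand, whose growth constant is the maximum of
  \<open>u\<close> there.\<close>

lemma Lagr_integrand_integrable:
  assumes G: "continuous_on UNIV (\<lambda>(p, q). G p q)" and u: "loc_abs_cont u"
    and bd: "\<And>t. t \<in> {a..b} \<Longrightarrow> \<bar>G (u t) (vderiv u t)\<bar> \<le> M * norm (vderiv u t)"
  shows "(\<lambda>t. G (u t) (vderiv u t) :: real) absolutely_integrable_on {a..b}"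
proof (rule measurable_bounded_by_integrable_imp_absolutely_integrable)
  have "u \<in> borel_measurable (lebesgue_on {a..b})"
    using loc_abs_contD(4)[OF u] continuous_on_subset by (intro continuous_imp_measurable_on_sets_lebesgue) auto
  moreover have "vderiv u \<in> borel_measurable (lebesgue_on {a..b})"
    using vderiv_integrable[OF u] by (rule integrable_imp_measurable)
  ultimately have "(\<lambda>t. (u t, vderiv u t)) \<in> borel_measurable (lebesgue_on {a..b})"
    by (rule borel_measurable_Pair)
  from measurable_compose[OF this borel_measurable_continuous_onI[OF G]]
  show "(\<lambda>t. G (u t) (vderiv u t)) \<in> borel_measurable (lebesgue_on {a..b})" by simp
  show "(\<lambda>t. M * norm (vderiv u t)) integrable_on {a..b}"
    using norm_vderiv_integrable[OF u] by (rule integrable_on_mult_right)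
qed (use bd in auto)

lemma loc_abs_cont_translate: "loc_abs_cont u \<Longrightarrow> loc_abs_cont (\<lambda>t. u t + c)"
  by (simp add: loc_abs_cont_def)

text \<open>This holds even where \<open>u\<close> is not differentiable:
  \<open>vector_derivative\<close> chooses a value satisfying a predicate, and the predicate is the
  same for both curves.\<close>

lemma vderiv_translate: "vderiv (\<lambda>t. u t + c) t = vderiv u t"
proof -
  have "((\<lambda>t. u t + c) has_vector_derivative D) (at t) \<longleftrightarrow> (u has_vector_derivative D) (at t)" for D
    using has_vector_derivative_add[OF _ has_vector_derivative_const, of u D "at t" c]
      has_vector_derivative_add[OF _ has_vector_derivative_const, of "\<lambda>t. u t + c" D "at t" "- c"]
    by auto
  then show ?thesis by (simp add: vector_derivative_def)
qed

lemma area_integrable: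
  assumes "loc_abs_cont u"
  shows "(\<lambda>t. u t \<bullet> (\<i> * vderiv u t)) absolutely_integrable_on {a..b}"
proof -
  obtain M where M: "\<And>t. t \<in> {a..b} \<Longrightarrow> norm (u t) \<le> M"
    using compact_imp_bounded[OF compact_continuous_image[OF continuous_on_subset[OF loc_abs_contD(4)[OF assms], of "{a..b}"]]]
    by (auto simp: bounded_iff simp del: atLeastAtMost_iff)
  have "(\<lambda>t. (\<lambda>p q. p \<bullet> (\<i> * q)) (u t) (vderiv u t)) absolutely_integrable_on {a..b}"
  proof (rule Lagr_integrand_integrable[OF _ assms, where M = M])
    show "continuous_on UNIV (\<lambda>(p, q). p \<bullet> (\<i> * q))"
      unfolding split_beta by (intro continuous_intros)
    fix t assume t: "t \<in> {a..b}"
    have "\<bar>u t \<bullet> (\<i> * vderiv u t)\<bar> \<le> norm (u t) * norm (vderiv u t)"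
      using Cauchy_Schwarz_ineq2[of "u t" "\<i> * vderiv u t"] by (simp add: norm_mult)
    also have "\<dots> \<le> M * norm (vderiv u t)" by (intro mult_right_mono M t) simp
    finally show "\<bar>u t \<bullet> (\<i> * vderiv u t)\<bar> \<le> M * norm (vderiv u t)" .
  qed
  then show ?thesis by simp
qed

text \<open>The translation contributes the inner product of \<open>c\<close> with the rotated
  integral of the derivative, which is \<open>u 1 - u 0\<close> and vanishes for a closed
  curve.\<close>

lemma area_translate:
  assumes "u \<in> W11"
  shows "area (\<lambda>t. u t + c) = area u"
proof -
  have u: "loc_abs_cont u" and per: "u 1 = u 0" using assms by (auto simp: W11_iff dest: spec[of _ 0])
  have "((\<lambda>t. c \<bullet> (\<i> * vderiv u t)) has_integral c \<bullet> (\<i> * (u 1 - u 0))) {0..1}"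
    using has_integral_linear[OF loc_abs_contD(2)[OF u, of 0 1], of "\<lambda>x. c \<bullet> (\<i> * x)"]
    by (simp add: o_def bounded_linear_inner_right_comp bounded_linear_mult_right)
  moreover have "((\<lambda>t. u t \<bullet> (\<i> * vderiv u t)) has_integral integral {0..1} (\<lambda>t. u t \<bullet> (\<i> * vderiv u t))) {0..1}"
    using area_integrable[OF u] set_lebesgue_integral_eq_integral(1) by blast
  ultimately have "((\<lambda>t. u t \<bullet> (\<i> * vderiv u t) + c \<bullet> (\<i> * vderiv u t)) has_integral
     (integral {0..1} (\<lambda>t. u t \<bullet> (\<i> * vderiv u t)) + c \<bullet> (\<i> * (u 1 - u 0)))) {0..1}"
    using has_integral_add by blast
  then show ?thesis
    by (simp add: area_def vderiv_translate inner_add_left per integral_unique)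
qed

lemma translate_in_Mset: "u \<in> Mset \<tau> \<Longrightarrow> (\<lambda>t. u t + c) \<in> Mset \<tau>"
  by (auto simp: Mset_def area_translate W11_iff loc_abs_cont_translate)

section \<open>Reparametrization\<close>

lemma periodic_of_int:
  fixes u :: "real \<Rightarrow> 'a"
  assumes per: "\<And>t. u (t + 1) = u t"
  shows "u (t + of_int n) = u t"
proof -
  have nat: "u (t + real n) = u t" for t n
  proof (induction n)
    case (Suc n)
    then show ?case using per[of "t + real n"] by (simp add: add_ac)
  qed simp
  show ?thesis
  proof (cases "n \<ge> 0")
    case True
    then show ?thesis using nat[of t "nat n"] by simp
  next
    case False
    then show ?thesis using nat[of "t + of_int n" "nat (- n)"] by simp
  qed
qed

text \<open>All integers carry the same value. For points in different unit cells one may therefore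
  jump from the first integer after \<open>x\<close> to \<open>\<lfloor>y\<rfloor>\<close> at no
  cost, and the two remaining pieces have total length at most \<open>y - x\<close>.\<close>

lemma lipschitz_on_periodic_extension:
  fixes u :: "real \<Rightarrow> complex"
  assumes lip: "L-lipschitz_on {0..1} u" and per: "\<And>t. u (t + 1) = u t"
  shows "L-lipschitz_on UNIV u"
proof (rule lipschitz_onI)
  show L: "0 \<le> L" using lip lipschitz_on_nonneg by blast
  note int = periodic_of_int[of u, OF per]
  have unit: "dist (u x) (u y) \<le> L * (y - x)" if "x \<le> y" "of_int n \<le> x" "y \<le> of_int n + 1" for x y n
  proof -
    have "dist (u (x - of_int n)) (u (y - of_int n)) \<le> L * dist (x - of_int n) (y - of_int n)"
      using that by (intro lipschitz_onD[OF lip]) auto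
    then show ?thesis using int[of x "-n"] int[of y "-n"] that by (simp add: dist_real_def)
  qed
  have le: "dist (u x) (u y) \<le> L * (y - x)" if xy: "x \<le> y" for x y
  proof (cases "\<lfloor>x\<rfloor> = \<lfloor>y\<rfloor>")
    case True
    show ?thesis by (rule unit[of x y "\<lfloor>x\<rfloor>"]) (use xy True in linarith)+
  next
    case False
    have fl: "\<lfloor>x\<rfloor> + 1 \<le> \<lfloor>y\<rfloor>" using False floor_mono[OF xy] by linarith
    have 1: "dist (u x) (u (of_int \<lfloor>x\<rfloor> + 1)) \<le> L * (of_int \<lfloor>x\<rfloor> + 1 - x)"
      by (rule unit[of _ _ "\<lfloor>x\<rfloor>"]) linarith+
    have 2: "dist (u (of_int \<lfloor>y\<rfloor>)) (u y) \<le> L * (y - of_int \<lfloor>y\<rfloor>)"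
      by (rule unit[of _ _ "\<lfloor>y\<rfloor>"]) linarith+
    have eq: "u (of_int \<lfloor>x\<rfloor> + 1) = u (of_int \<lfloor>y\<rfloor>)"
      using int[of 0 "\<lfloor>x\<rfloor> + 1"] int[of 0 "\<lfloor>y\<rfloor>"] by simp
    have "dist (u x) (u y) \<le> L * (of_int \<lfloor>x\<rfloor> + 1 - x) + L * (y - of_int \<lfloor>y\<rfloor>)"
      using dist_triangle[of "u x" "u y" "u (of_int \<lfloor>x\<rfloor> + 1)"] 1 2 by (simp add: eq)
    also have "\<dots> = L * ((of_int \<lfloor>x\<rfloor> + 1 - x) + (y - of_int \<lfloor>y\<rfloor>))" by (simp add: algebra_simps)
    also have "\<dots> \<le> L * (y - x)" using fl L by (intro mult_left_mono) linarith+
    finally show ?thesis .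
  qed
  show "dist (u x) (u y) \<le> L * dist x y" for x y
    using le[of x y] le[of y x] by (cases "x \<le> y") (auto simp: dist_commute dist_real_def)
qed

text \<open>Reparametrization: \<open>w \<circ> \<sigma> = u\<close>, where \<open>\<sigma>\<close> is the normalized integral of \<open>\<bar>u'\<bar> + 1\<close>; the
  additional 1 makes \<open>\<sigma>\<close> invertible with Lipschitz inverse.\<close>
lemma lipschitz_reparametrization:
  fixes u :: "real \<Rightarrow> complex"
  assumes u: "u \<in> W11"
  obtains w where "w \<in> W11" "(integral {0..1} (\<lambda>t. norm (vderiv u t)) + 1)-lipschitz_on UNIV w"
    "\<And>G. \<lbrakk>\<And>p q l. l > 0 \<Longrightarrow> G p (l *\<^sub>R q) = l * G p q;
           (\<lambda>t. G (u t) (vderiv u t)) absolutely_integrable_on {0..1}\<rbrakk> \<Longrightarrow> Lagr G w = Lagr G u"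
proof -
  have loc_abs_cont: "loc_abs_cont u" and per: "\<And>t. u (t + 1) = u t" using u by (auto simp: W11_iff)
  define K where "K = integral {0..1} (\<lambda>t. norm (vderiv u t)) + 1"
  have K: "K \<ge> 1" unfolding K_def using norm_vderiv_integrable[OF loc_abs_cont]
    by (simp add: integral_nonneg)
  define g where "g t = (norm (vderiv u t) + 1) / K" for t
  have gi: "g integrable_on {a..b}" for a b
    unfolding g_def using norm_vderiv_integrable[OF loc_abs_cont, of a b]
    by (intro integrable_on_divide integrable_add) auto
  have g_ge: "g t \<ge> 1 / K" for t using K by (simp add: g_def divide_right_mono)
  then have g_pos: "g t > 0" for t using K less_le_trans[of 0 "1/K" "g t"] by simp
  obtain \<sigma>0 where \<sigma>0: "\<And>a b. a \<le> b \<Longrightarrow> \<sigma>0 b - \<sigma>0 a = integral {a..b} g"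
    using ex_primitive[OF gi] by blast
  define \<sigma> where "\<sigma> t = \<sigma>0 t - \<sigma>0 0" for t
  have \<sigma>: "\<sigma> b - \<sigma> a = integral {a..b} g" if "a \<le> b" for a b using \<sigma>0[OF that] by (simp add: \<sigma>_def)
  have \<sigma>0': "\<sigma> 0 = 0" by (simp add: \<sigma>_def)
  have \<sigma>1: "\<sigma> 1 = 1"
  proof -
    have "integral {0..1} g = (integral {0..1} (\<lambda>t. norm (vderiv u t)) + integral {0..1} (\<lambda>t::real. 1)) / K"
      unfolding g_def using Henstock_Kurzweil_Integration.integral_add[OF norm_vderiv_integrable[OF loc_abs_cont, of 0 1] integrable_const_ivl[of "1::real" 0 1]]
      by (subst Henstock_Kurzweil_Integration.integral_divide) simp
    also have "\<dots> = 1" using K by (simp add: K_def)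
    finally show ?thesis using \<sigma>[of 0 1] \<sigma>0' by simp
  qed
  have \<sigma>_lb: "(b - a) / K \<le> \<sigma> b - \<sigma> a" if "a \<le> b" for a b
  proof -
    have "integral {a..b} (\<lambda>t. 1 / K) \<le> integral {a..b} g"
      by (intro integral_le gi) (use g_ge in auto)
    then show ?thesis using \<sigma>[OF that] that by simp
  qed
  \<comment> \<open>\<open>K * g\<close> dominates the speed of \<open>u\<close>, so
    \<open>u\<close> moves at most \<open>K\<close> times as far as \<sigma> does. Expressed in the
    variable s = \<sigma>(t), this is the Lipschitz bound for \<open>w\<close>.\<close>
  have \<sigma>_u: "norm (u b - u a) \<le> K * (\<sigma> b - \<sigma> a)" if "a \<le> b" for a b
  proof -
    have "u b - u a = integral {a..b} (vderiv u)" using loc_abs_contD(2)[OF loc_abs_cont that] by (simp add: integral_unique)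
    also have "norm \<dots> \<le> integral {a..b} (\<lambda>t. K * g t)"
    proof (rule integral_norm_bound_integral[OF vderiv_integrable[OF loc_abs_cont] integrable_on_mult_right[OF gi]])
      show "norm (vderiv u t) \<le> K * g t" for t using K by (simp add: g_def)
    qed
    also have "\<dots> = K * (\<sigma> b - \<sigma> a)" using \<sigma>[OF that] by simp
    finally show ?thesis .
  qed
  have mono: "\<sigma> a < \<sigma> b" if "a < b" for a b
  proof -
    have "0 < (b - a) / K" using that K by simp
    then show ?thesis using \<sigma>_lb[of a b] that by simp
  qed
  have inj: "inj \<sigma>" by (metis injI linorder_neqE_linordered_idom mono less_irrefl)
  obtain N1 where N1: "negligible N1" "\<And>t. t \<notin> N1 \<Longrightarrow> (\<sigma> has_vector_derivative g t) (at t)"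
    using primitive_has_derivative_ae[OF gi \<sigma>] by blast
  obtain N2 where N2: "negligible N2" "\<And>t. t \<notin> N2 \<Longrightarrow> (u has_vector_derivative vderiv u t) (at t)"
    using loc_abs_contD(3)[OF loc_abs_cont] by blast
  have "continuous_on {0..1} (\<lambda>x. integral {0..x} g)" by (rule indefinite_integral_continuous_1[OF gi])
  then have cont\<sigma>: "continuous_on {0..1} \<sigma>"
    by (rule continuous_on_eq) (use \<sigma>[of 0] \<sigma>0' in auto)
  define \<phi> where "\<phi> s = inv_into {0..1} \<sigma> s" for s
  have surj: "\<sigma> ` {0..1} = {0..1}"
  proof (intro subset_antisym subsetI)
    fix s assume "s \<in> \<sigma> ` {0..1}"
    then obtain t where t: "0 \<le> t" "t \<le> 1" "s = \<sigma> t" by auto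
    have "0 \<le> \<sigma> t" using t mono[of 0 t] \<sigma>0' by (cases "t = 0") auto
    moreover have "\<sigma> t \<le> 1" using t mono[of t 1] \<sigma>1 by (cases "t = 1") auto
    ultimately show "s \<in> {0..1}" using t by simp
  next
    fix s :: real assume "s \<in> {0..1}"
    then show "s \<in> \<sigma> ` {0..1}"
      using IVT'[of \<sigma> 0 s 1] cont\<sigma> \<sigma>0' \<sigma>1 by force
  qed
  have \<sigma>\<phi>: "\<sigma> (\<phi> s) = s" and \<phi>_in: "\<phi> s \<in> {0..1}" if "s \<in> {0..1}" for s
    using that surj by (auto simp: \<phi>_def f_inv_into_f inv_into_into simp del: atLeastAtMost_iff)
  have \<phi>\<sigma>: "\<phi> (\<sigma> t) = t" if "t \<in> {0..1}" for t
    using that inj by (simp add: \<phi>_def inv_into_f_f inj_on_subset[OF inj] del: atLeastAtMost_iff)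
  have \<phi>_mono: "\<phi> a \<le> \<phi> b" if "a \<in> {0..1}" "b \<in> {0..1}" "a \<le> b" for a b
    using mono[of "\<phi> b" "\<phi> a"] \<sigma>\<phi>[OF that(1)] \<sigma>\<phi>[OF that(2)] that(3) by linarith
  \<comment> \<open>The use of \<open>frac\<close> makes \<open>w\<close> periodic. At s = 1 it
    returns the value at 0, which agrees with \<open>u (\<phi> 1)\<close> because \<open>u\<close>
    is closed.\<close>
  define w where "w s = u (\<phi> (frac s))" for s
  have \<phi>01: "\<phi> 0 = 0" "\<phi> 1 = 1" using \<phi>\<sigma>[of 0] \<phi>\<sigma>[of 1] \<sigma>0' \<sigma>1 by auto
  have w_eq: "w s = u (\<phi> s)" if "s \<in> {0..1}" for s
  proof (cases "s = 1")
    case True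
    then show ?thesis using \<phi>01 per[of 0] by (simp add: w_def frac_def)
  next
    case False
    then have "frac s = s" using that by (simp add: frac_eq)
    then show ?thesis by (simp add: w_def)
  qed
  have w_per: "w (s + 1) = w s" for s by (simp add: w_def frac_def)
  have w\<sigma>: "w (\<sigma> t) = u t" if "t \<in> {0..1}" for t
    using w_eq[of "\<sigma> t"] \<phi>\<sigma>[OF that] surj that by (metis image_eqI)
  have "K-lipschitz_on {0..1} w"
  proof (rule lipschitz_on_leI)
    fix x y :: real assume xy: "x \<in> {0..1}" "y \<in> {0..1}" "x \<le> y"
    show "dist (w x) (w y) \<le> K * dist x y"
      using \<sigma>_u[OF \<phi>_mono[OF xy]] xy \<sigma>\<phi>[OF xy(1)] \<sigma>\<phi>[OF xy(2)] w_eq[OF xy(1)] w_eq[OF xy(2)]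
      by (simp add: dist_norm norm_minus_commute)
  qed (use K in simp)
  from lipschitz_on_periodic_extension[OF this w_per] have w_lip: "K-lipschitz_on UNIV w" .
  have wW: "w \<in> W11" using w_per loc_abs_cont_lipschitz[OF w_lip] by (simp add: W11_iff)
  \<comment> \<open>The change of variables formula wants \<sigma> differentiable at every point of
    the domain, and the chain rule wants the same of \<open>u\<close>. \<open>S\<close> is a set of
    full measure where both hold.\<close>
  define S where "S = {0<..<1} - (N1 \<union> N2)"
  have S_leb: "S \<in> sets lebesgue"
    unfolding S_def using N1 N2 negligible_imp_sets by (intro sets.Diff sets.Un) auto
  have S_sub: "S \<subseteq> {0..1}" by (auto simp: S_def)
  have S_neg: "negligible ({0..1} - S)"
  proof (rule negligible_subset)
    show "negligible (N1 \<union> N2 \<union> {0,1})" using N1 N2 by simp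
  qed (auto simp: S_def)
  have der\<sigma>: "(\<sigma> has_field_derivative g t) (at t)" if "t \<in> S" for t
    using N1(2)[of t] that by (simp add: S_def has_real_derivative_iff_has_vector_derivative)
  have int_S: "h absolutely_integrable_on S \<and> integral S h = b"
    if "h absolutely_integrable_on {0..1}" "integral {0..1} h = b" for h :: "real \<Rightarrow> real" and b
  proof -
    have "{x \<in> S - {0..1}. h x \<noteq> 0} = {}" using S_sub by blast
    then have neg: "negligible {x \<in> S - {0..1}. h x \<noteq> 0}" "negligible {x \<in> {0..1} - S. h x \<noteq> 0}"
      by (metis negligible_empty) (rule negligible_subset[OF S_neg], blast)
    show ?thesis
      using that absolutely_integrable_spike_set_eq[OF neg] integral_spike_set[OF neg] by simp
  qed
  have cov: "(\<lambda>t. \<bar>g t\<bar> * f (\<sigma> t)) absolutely_integrable_on S \<and> integral S (\<lambda>t. \<bar>g t\<bar> * f (\<sigma> t)) = b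
     \<longleftrightarrow> f absolutely_integrable_on \<sigma> ` S \<and> integral (\<sigma> ` S) f = b" for f :: "real \<Rightarrow> real" and b
    by (intro has_absolute_integral_change_of_variables_1' S_leb inj_on_subset[OF inj])
       (auto intro: DERIV_subset der\<sigma>)
  have \<sigma>S_sub: "\<sigma> ` S \<subseteq> {0..1}" using S_sub surj by blast
  \<comment> \<open>The change of variables formula for the constant 1 gives \<sigma>(S) the measure
    \<integral>g = 1, so its complement in the unit interval is null.\<close>
  have \<sigma>S_neg: "negligible ({0..1} - \<sigma> ` S)"
  proof -
    have "g absolutely_integrable_on {0..1}"
      using gi g_pos by (intro nonnegative_absolutely_integrable_1) (auto intro: less_imp_le)
    then have "(\<lambda>t. \<bar>g t\<bar> * (\<lambda>_. 1) (\<sigma> t)) absolutely_integrable_on S \<and> integral S (\<lambda>t. \<bar>g t\<bar> * (\<lambda>_. 1) (\<sigma> t)) = 1"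
      using int_S[of g 1] g_pos \<sigma>[of 0 1] \<sigma>0' \<sigma>1 by (simp add: abs_of_pos)
    then have 1: "(\<lambda>_. 1::real) absolutely_integrable_on \<sigma> ` S" "integral (\<sigma> ` S) (\<lambda>_. 1::real) = 1"
      using cov[of "\<lambda>_. 1" 1] by auto
    then have m: "\<sigma> ` S \<in> lmeasurable" "measure lebesgue (\<sigma> ` S) = 1"
      using lmeasurable_iff_integrable_on lmeasure_integral set_lebesgue_integral_eq_integral(1) by metis+
    have "measure lebesgue ({0..1} - \<sigma> ` S) = 0"
      using m \<sigma>S_sub by (subst measurable_measure_Diff) auto
    then show ?thesis using m by (subst negligible_iff_measure0) (auto intro: fmeasurable.Diff)
  qed
  have derw: "vderiv w (\<sigma> t) = (1 / g t) *\<^sub>R vderiv u t" if t: "t \<in> S" for t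
  proof -
    have t01: "0 < t" "t < 1" using t by (auto simp: S_def)
    have \<sigma>t: "0 < \<sigma> t" "\<sigma> t < 1" using mono[OF t01(1)] mono[OF t01(2)] \<sigma>0' \<sigma>1 by auto
    have "continuous_on {0..1} \<phi>"
      using continuous_on_inv[OF cont\<sigma> compact_Icc, of \<phi>] \<phi>\<sigma> surj by auto
    then have "isCont \<phi> (\<sigma> t)"
      using \<sigma>t by (intro continuous_on_interior[of "{0..1}"]) auto
    then have "DERIV \<phi> (\<sigma> t) :> inverse (g t)"
      using \<sigma>t der\<sigma>[OF t] g_pos[of t] \<phi>\<sigma>[of t] t01 \<sigma>\<phi>
      by (intro DERIV_inverse_function[where f = \<sigma> and a = 0 and b = 1]) auto
    then have "(\<phi> has_vector_derivative inverse (g t)) (at (\<sigma> t))"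
      by (simp add: has_real_derivative_iff_has_vector_derivative)
    moreover have "(u has_vector_derivative vderiv u t) (at (\<phi> (\<sigma> t)))"
      using N2(2)[of t] t \<phi>\<sigma>[of t] t01 by (simp add: S_def)
    ultimately have "(u \<circ> \<phi> has_vector_derivative inverse (g t) *\<^sub>R vderiv u t) (at (\<sigma> t))"
      by (rule vector_diff_chain_at)
    then have "(w has_vector_derivative inverse (g t) *\<^sub>R vderiv u t) (at (\<sigma> t))"
      by (rule has_vector_derivative_transform_within_open[of _ _ _ "{0<..<1}"]) (use \<sigma>t w_eq in auto)
    then show ?thesis by (simp add: vector_derivative_at inverse_eq_divide)
  qed
  show thesis
  proof (rule that[OF wW])
    show "(integral {0..1} (\<lambda>t. norm (vderiv u t)) + 1)-lipschitz_on UNIV w"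
      using w_lip by (simp add: K_def)
    \<comment> \<open>\<open>G\<close> is arbitrary so that one and the same \<open>w\<close>
      preserves both the energy and the area. The factor \<open>g t\<close> from the change of
      variables cancels against the factor \<open>1 / g t\<close> that homogeneity extracts from the
      derivative of \<open>w\<close>.\<close>
    fix G :: "complex \<Rightarrow> complex \<Rightarrow> real"
    assume hom: "\<And>p q l. l > 0 \<Longrightarrow> G p (l *\<^sub>R q) = l * G p q"
      and Gi: "(\<lambda>t. G (u t) (vderiv u t)) absolutely_integrable_on {0..1}"
    have eq: "\<bar>g t\<bar> * G (w (\<sigma> t)) (vderiv w (\<sigma> t)) = G (u t) (vderiv u t)" if "t \<in> S" for t
      using g_pos[of t] w\<sigma>[of t] that S_sub hom[of "1 / g t"] by (auto simp: derw)
    have "(\<lambda>t. G (u t) (vderiv u t)) absolutely_integrable_on S \<and> integral S (\<lambda>t. G (u t) (vderiv u t)) = Lagr G u"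
      using Gi by (intro int_S) (auto simp: Lagr_def)
    then have "(\<lambda>t. \<bar>g t\<bar> * G (w (\<sigma> t)) (vderiv w (\<sigma> t))) absolutely_integrable_on S
      \<and> integral S (\<lambda>t. \<bar>g t\<bar> * G (w (\<sigma> t)) (vderiv w (\<sigma> t))) = Lagr G u"
      using eq by (simp cong: integral_cong set_integrable_cong)
    then have "integral (\<sigma> ` S) (\<lambda>s. G (w s) (vderiv w s)) = Lagr G u"
      using cov[of "\<lambda>s. G (w s) (vderiv w s)" "Lagr G u"] by simp
    also have "integral (\<sigma> ` S) (\<lambda>s. G (w s) (vderiv w s)) = Lagr G w"
      unfolding Lagr_def using \<sigma>S_sub
      by (intro integral_spike_set negligible_subset[OF \<sigma>S_neg]) (auto intro: empty_imp_negligible)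
    finally show "Lagr G w = Lagr G u" .
  qed
qed

section \<open>Semicontinuity of the energy and continuity of the area\<close>

text \<open>The area integrand is homogeneous of degree one in \<open>q\<close>, so in this form it
  can be fed to \<open>lipschitz_reparametrization\<close>.\<close>

lemma area_eq_Lagr: "area u = 1/2 * Lagr (\<lambda>p q. p \<bullet> (\<i> * q)) u"
  by (simp add: area_def Lagr_def)

lemma integral_le_ae:
  fixes f g :: "real \<Rightarrow> real"
  assumes "f integrable_on S" "g integrable_on S" "negligible N" "\<And>x. x \<in> S - N \<Longrightarrow> f x \<le> g x"
  shows "integral S f \<le> integral S g"
proof -
  let ?g = "\<lambda>x. if x \<in> N then f x else g x"
  have "?g integrable_on S" by (rule integrable_spike[OF assms(2,3)]) simp
  then have "integral S f \<le> integral S ?g" using assms(1,4) by (intro integral_le) auto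
  also have "integral S ?g = integral S g" by (rule integral_spike[OF assms(3)]) simp
  finally show ?thesis .
qed

text \<open>Jensen's inequality by separation. If the pair (\<open>m\<close>, \<open>r\<close>) of
  the means of \<open>g\<close> and of \<open>f\<close> along \<open>g\<close> lay outside the
  closed convex epigraph of \<open>f\<close>, a hyperplane would separate it strictly; averaging the
  separating inequality over the points (g t, f (g t)) of the epigraph gives a contradiction.
  Homogeneity then turns means into integrals.\<close>

lemma sublinear_integral_le:
  fixes f :: "'b::euclidean_space \<Rightarrow> real" and g :: "real \<Rightarrow> 'b"
  assumes cont: "continuous_on UNIV f" and conv: "convex_on UNIV f"
    and hom: "\<And>l q. l > 0 \<Longrightarrow> f (l *\<^sub>R q) = l * f q"
    and gi: "g integrable_on {a..b}" and fgi: "(\<lambda>t. f (g t)) integrable_on {a..b}" and ab: "a < b"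
  shows "f (integral {a..b} g) \<le> integral {a..b} (\<lambda>t. f (g t))"
proof -
  define m where "m = integral {a..b} g /\<^sub>R (b - a)"
  define r where "r = integral {a..b} (\<lambda>t. f (g t)) / (b - a)"
  have "f m \<le> r"
  proof (rule ccontr)
    assume "\<not> f m \<le> r"
    then have "(m, r) \<notin> epigraph UNIV f" by (simp add: epigraph_def)
    moreover have "convex (epigraph UNIV f)" using conv by (simp add: convex_epigraph)
    moreover have "closed (epigraph UNIV f)"
      unfolding epigraph_def
      by (simp, intro closed_Collect_le continuous_on_compose2[OF cont] continuous_intros) auto
    ultimately obtain A B where A: "inner A (m, r) < B" "\<And>x. x \<in> epigraph UNIV f \<Longrightarrow> inner A x > B"
      using separating_hyperplane_closed_point by meson
    obtain A1 A2 where AA: "A = (A1, A2)" by (cases A)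
    have "((\<lambda>t. B) has_integral (b - a) * B) {a..b}"
      using ab has_integral_const_real[of B a b] by simp
    moreover have "((\<lambda>t. A1 \<bullet> g t + A2 * f (g t)) has_integral
      (A1 \<bullet> integral {a..b} g + A2 * integral {a..b} (\<lambda>t. f (g t)))) {a..b}"
      using has_integral_linear[OF integrable_integral[OF gi] bounded_linear_inner_right[of A1]]
      by (intro has_integral_add has_integral_mult_right integrable_integral fgi) (simp add: o_def)
    moreover have "B \<le> A1 \<bullet> g t + A2 * f (g t)" for t
      using A(2)[of "(g t, f (g t))"] by (simp add: AA epigraph_def)
    ultimately have "(b - a) * B \<le> A1 \<bullet> integral {a..b} g + A2 * integral {a..b} (\<lambda>t. f (g t))"
      by (rule has_integral_le)
    also have "\<dots> = (b - a) * inner A (m, r)"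
    proof -
      have "integral {a..b} g = (b - a) *\<^sub>R m" "integral {a..b} (\<lambda>t. f (g t)) = (b - a) * r"
        using ab by (simp_all add: m_def r_def)
      then show ?thesis by (simp only: AA) (simp add: algebra_simps)
    qed
    finally show False using A(1) ab by simp
  qed
  then have "(b - a) * f m \<le> integral {a..b} (\<lambda>t. f (g t))" using ab by (simp add: r_def field_simps)
  moreover have "f (integral {a..b} g) = (b - a) * f m"
    using hom[of "b - a" m] ab by (simp add: m_def)
  ultimately show ?thesis by simp
qed

text \<open>A primitive \<Phi> turns the claim into one about single integrals, without exchanging
  the order of integration. The integral of \<Phi>(t + h) - \<Phi>(t) over [0, 1] equals that of
  \<Phi>(t + 1) - \<Phi>(t) over [0, h], and the latter integrand is constant by
  periodicity.\<close>

lemma integral_average_periodic: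
  fixes G :: "real \<Rightarrow> real"
  assumes Gi: "\<And>a b. G integrable_on {a..b}" and per: "\<And>t. G (t + 1) = G t" and h: "0 < h" "h < 1"
  shows "((\<lambda>t. integral {t..t+h} G) has_integral h * integral {0..1} G) {0..1}"
proof -
  obtain \<Phi> where \<Phi>: "\<And>a b. a \<le> b \<Longrightarrow> \<Phi> b - \<Phi> a = integral {a..b} G"
    using ex_primitive[OF Gi] by blast
  have "continuous_on {0..2} (\<lambda>x. \<Phi> 0 + integral {0..x} G)"
    by (intro continuous_intros indefinite_integral_continuous_1[OF Gi])
  then have cont: "continuous_on {0..2} \<Phi>" by (rule continuous_on_eq) (use \<Phi>[of 0, symmetric] in auto)
  have \<Phi>i: "\<Phi> integrable_on {a..b}" if "0 \<le> a" "b \<le> 2" for a b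
    using that by (intro integrable_continuous_real continuous_on_subset[OF cont]) auto
  have sh: "((\<lambda>t. \<Phi> (t + h)) has_integral integral {h..1+h} \<Phi>) {0..1}"
    using has_integral_shift_real_ivl[OF integrable_integral[OF \<Phi>i[of h "1+h"]], of h] h by simp
  have shift1: "\<Phi> (t + 1) - \<Phi> t = integral {0..1} G" if "0 \<le> t" "t \<le> 1" for t
  proof -
    have "integral {1..t+1} G = integral {0..t} G"
      using integral_shift_real_ivl[of 1 1 "t+1" G] per by simp
    then show ?thesis using \<Phi>[of 1 "t+1"] \<Phi>[of 0 t] \<Phi>[of 0 1] that by simp
  qed
  have s1: "((\<lambda>t. \<Phi> (t + 1)) has_integral integral {1..1+h} \<Phi>) {0..h}"
    using has_integral_shift_real_ivl[OF integrable_integral[OF \<Phi>i[of 1 "1+h"]], of 1] h by simp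
  have "((\<lambda>t. \<Phi> (t + 1) - \<Phi> t) has_integral integral {1..1+h} \<Phi> - integral {0..h} \<Phi>) {0..h}"
    using h by (intro has_integral_diff s1 integrable_integral \<Phi>i) auto
  moreover have "((\<lambda>t. \<Phi> (t + 1) - \<Phi> t) has_integral h * integral {0..1} G) {0..h}"
    using shift1 h has_integral_const_real[of "integral {0..1} G" 0 h]
    by (subst has_integral_cong[where g = "\<lambda>_. integral {0..1} G"]) auto
  ultimately have 1: "integral {1..1+h} \<Phi> - integral {0..h} \<Phi> = h * integral {0..1} G"
    by (rule has_integral_unique)
  have "integral {h..1} \<Phi> + integral {1..1+h} \<Phi> = integral {h..1+h} \<Phi>"
    "integral {0..h} \<Phi> + integral {h..1} \<Phi> = integral {0..1} \<Phi>"
    using h by (intro Henstock_Kurzweil_Integration.integral_combine \<Phi>i; simp)+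
  then have "integral {h..1+h} \<Phi> - integral {0..1} \<Phi> = h * integral {0..1} G" using 1 by simp
  moreover have "((\<lambda>t. \<Phi> (t + h) - \<Phi> t) has_integral integral {h..1+h} \<Phi> - integral {0..1} \<Phi>) {0..1}"
    by (intro has_integral_diff sh integrable_integral \<Phi>i) auto
  ultimately show ?thesis using \<Phi> h
    by (subst has_integral_cong[where g = "\<lambda>t. \<Phi> (t + h) - \<Phi> t"]) auto
qed

lemma vderiv_periodic:
  assumes per: "\<And>t. u (t + 1) = u t"
  shows "vderiv u (t + 1) = vderiv u t"
proof -
  have "((\<lambda>x. x + c) has_vector_derivative 1) (at x)" for x c :: real
    by (auto intro!: derivative_eq_intros simp: has_real_derivative_iff_has_vector_derivative[symmetric])
  then have *: "((\<lambda>x. u (x + c)) has_vector_derivative D) (at x)" if "(u has_vector_derivative D) (at (x + c))" for D x c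
    using vector_diff_chain_at[of "\<lambda>x. x + c" 1 x u D] that
    by (auto simp: o_def)
  have "(\<lambda>x. u (x + 1)) = u" "(\<lambda>x. u (x + - 1)) = u" using per per[of "x - 1" for x] by auto
  then have "(u has_vector_derivative D) (at (t + 1)) \<longleftrightarrow> (u has_vector_derivative D) (at t)" for D
    using *[of D t 1] *[of D "t + 1" "-1"] by auto
  then show ?thesis by (simp add: vector_derivative_def)
qed

text \<open>Only the distance of the curves may enter, not that of their derivatives. With d = u -
  w, the difference of the integrands contains w \<bullet> (i d'). Subtracting the derivative of w
  \<bullet> (i d), whose integral over a period is 0, replaces this term by -w' \<bullet> (i d).
  What remains is d \<bullet> (i u') - w' \<bullet> (i d), which is at most 2 L B in absolute
  value.\<close>

lemma area_diff_le:
  assumes u: "u \<in> W11" "L-lipschitz_on UNIV u" and w: "w \<in> W11" "L-lipschitz_on UNIV w"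
    and B: "\<And>t. norm (u t - w t) \<le> B"
  shows "\<bar>area u - area w\<bar> \<le> L * B"
proof -
  have L: "0 \<le> L" using u lipschitz_on_nonneg by blast
  have B0: "0 \<le> B" using B[of 0] norm_ge_zero order_trans by blast
  define d where "d t = u t - w t" for t
  have ul: "loc_abs_cont u" and wl: "loc_abs_cont w" and uper: "\<And>t. u (t + 1) = u t" and wper: "\<And>t. w (t + 1) = w t"
    using u w by (auto simp: W11_iff)
  have d_lip: "(2 * L)-lipschitz_on UNIV d"
  proof (rule lipschitz_onI)
    show "dist (d x) (d y) \<le> 2 * L * dist x y" for x y
    proof -
      have "d x - d y = (u x - u y) - (w x - w y)" by (simp add: d_def)
      then have "norm (d x - d y) \<le> norm (u x - u y) + norm (w x - w y)" by (simp add: norm_triangle_ineq4)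
      then show ?thesis
        using lipschitz_onD[OF u(2), of x y] lipschitz_onD[OF w(2), of x y] by (simp add: dist_norm)
    qed
  qed (use L in simp)
  obtain M where M: "\<And>t. t \<in> {0..1} \<Longrightarrow> norm (w t) \<le> M"
    using compact_imp_bounded[OF compact_continuous_image[OF continuous_on_subset[OF loc_abs_contD(4)[OF wl], of "{0..1}"]]]
    by (auto simp: bounded_iff simp del: atLeastAtMost_iff)
  have M0: "0 \<le> M" using order_trans[OF norm_ge_zero M[of 0]] by simp
  \<comment> \<open>The function is real-valued; the cast to complex numbers makes
    \<open>loc_abs_cont\<close> and its consequences applicable.\<close>
  define f where "f t = complex_of_real (w t \<bullet> (\<i> * d t))" for t
  have "(M * (2 * L) + L * B)-lipschitz_on {0..1} f"
  proof (rule lipschitz_onI)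
    fix x y :: real assume x: "x \<in> {0..1}" and y: "y \<in> {0..1}"
    have "f x - f y = complex_of_real (w x \<bullet> (\<i> * (d x - d y)) + (w x - w y) \<bullet> (\<i> * d y))"
      by (simp add: f_def inner_diff_left inner_diff_right right_diff_distrib)
    then have "dist (f x) (f y) \<le> \<bar>w x \<bullet> (\<i> * (d x - d y))\<bar> + \<bar>(w x - w y) \<bullet> (\<i> * d y)\<bar>"
      by (simp only: dist_norm norm_of_real abs_triangle_ineq)
    also have "\<dots> \<le> norm (w x) * norm (d x - d y) + norm (w x - w y) * norm (d y)"
      using Cauchy_Schwarz_ineq2[of "w x" "\<i> * (d x - d y)"] Cauchy_Schwarz_ineq2[of "w x - w y" "\<i> * d y"]
      by (simp add: norm_mult)
    also have "\<dots> \<le> M * (2 * L * dist x y) + (L * dist x y) * B"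
      using M[OF x] B[of y] lipschitz_onD[OF d_lip, of x y] lipschitz_onD[OF w(2), of x y] L M0
      by (intro add_mono mult_mono) (auto simp: dist_norm d_def)
    finally show "dist (f x) (f y) \<le> (M * (2 * L) + L * B) * dist x y" by (simp add: algebra_simps)
  qed (use M0 L B0 in simp)
  moreover have f_per: "f (t + 1) = f t" for t by (simp add: f_def d_def uper wper)
  ultimately have f_lac: "loc_abs_cont f" by (intro loc_abs_cont_lipschitz[OF lipschitz_on_periodic_extension])
  obtain Nu where Nu: "negligible Nu" "\<And>t. t \<notin> Nu \<Longrightarrow> (u has_vector_derivative vderiv u t) (at t)"
    using loc_abs_contD(3)[OF ul] by blast
  obtain Nw where Nw: "negligible Nw" "\<And>t. t \<notin> Nw \<Longrightarrow> (w has_vector_derivative vderiv w t) (at t)"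
    using loc_abs_contD(3)[OF wl] by blast
  have N: "negligible (Nu \<union> Nw)" using Nu Nw by simp
  let ?d' = "\<lambda>t. vderiv u t - vderiv w t"
  have vf: "Re (vderiv f t) = vderiv w t \<bullet> (\<i> * d t) + w t \<bullet> (\<i> * ?d' t)" if "t \<notin> Nu \<union> Nw" for t
  proof -
    have "(d has_vector_derivative ?d' t) (at t)"
      unfolding d_def using Nu(2)[of t] Nw(2)[of t] that by (intro has_vector_derivative_diff) auto
    then have "((\<lambda>t. \<i> * d t) has_vector_derivative \<i> * ?d' t) (at t)"
      by (rule has_vector_derivative_mult_right)
    then have "((\<lambda>t. w t \<bullet> (\<i> * d t)) has_vector_derivative w t \<bullet> (\<i> * ?d' t) + vderiv w t \<bullet> (\<i> * d t)) (at t)"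
      using bounded_bilinear.has_vector_derivative[OF bounded_bilinear_inner Nw(2)[of t]] that by auto
    then have "(f has_vector_derivative of_real (w t \<bullet> (\<i> * ?d' t) + vderiv w t \<bullet> (\<i> * d t))) (at t)"
      unfolding f_def by (rule bounded_linear.has_vector_derivative[OF bounded_linear_of_real])
    then have "vderiv f t = of_real (w t \<bullet> (\<i> * ?d' t) + vderiv w t \<bullet> (\<i> * d t))"
      by (rule vector_derivative_at)
    then show ?thesis by simp
  qed
  have int0: "((\<lambda>t. Re (vderiv f t)) has_integral 0) {0..1}"
    using has_integral_linear[OF loc_abs_contD(2)[OF f_lac, of 0 1] bounded_linear_Re] f_per[of 0] by (simp add: o_def)
  let ?a = "\<lambda>u t. u t \<bullet> (\<i> * vderiv u t)"
  have ai: "(?a v has_integral 2 * area v) {0..1}" if "loc_abs_cont v" for v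
    using integrable_integral[OF set_lebesgue_integral_eq_integral(1)[OF area_integrable[OF that, of 0 1]]]
    by (simp add: area_def)
  have I0: "((\<lambda>t. ?a u t - ?a w t - Re (vderiv f t)) has_integral 2 * area u - 2 * area w - 0) {0..1}"
    by (intro has_integral_diff ai ul wl int0)
  have I: "((\<lambda>t. d t \<bullet> (\<i> * vderiv u t) - vderiv w t \<bullet> (\<i> * d t)) has_integral 2 * area u - 2 * area w) {0..1}"
  proof -
    have "d t \<bullet> (\<i> * vderiv u t) - vderiv w t \<bullet> (\<i> * d t) = ?a u t - ?a w t - Re (vderiv f t)"
      if "t \<in> {0..1} - (Nu \<union> Nw)" for t
      using vf[of t] that by (simp add: d_def inner_diff_left inner_diff_right right_diff_distrib)
    from has_integral_spike[OF N this I0] show ?thesis by simp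
  qed
  define k where "k = (\<lambda>t. d t \<bullet> (\<i> * vderiv u t) - vderiv w t \<bullet> (\<i> * d t))"
  have kI: "(k has_integral 2 * area u - 2 * area w) {0..1}" using I unfolding k_def .
  have bd: "\<bar>k t\<bar> \<le> 2 * (L * B)" if "t \<in> {0..1} - (Nu \<union> Nw)" for t
  proof -
    have t: "t \<notin> Nu" "t \<notin> Nw" using that by auto
    have vu: "norm (vderiv u t) \<le> L" and vw: "norm (vderiv w t) \<le> L"
      using norm_vderiv_le_lipschitz[OF u(2) Nu(2)[OF t(1)]] norm_vderiv_le_lipschitz[OF w(2) Nw(2)[OF t(2)]] .
    have dB: "norm (d t) \<le> B" using B[of t] unfolding d_def .
    have "\<bar>d t \<bullet> (\<i> * vderiv u t)\<bar> \<le> norm (d t) * norm (vderiv u t)"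
      using Cauchy_Schwarz_ineq2[of "d t" "\<i> * vderiv u t"] by (simp add: norm_mult)
    also have "\<dots> \<le> B * L" using dB vu B0 by (intro mult_mono) auto
    finally have 1: "\<bar>d t \<bullet> (\<i> * vderiv u t)\<bar> \<le> B * L" .
    have "\<bar>vderiv w t \<bullet> (\<i> * d t)\<bar> \<le> norm (vderiv w t) * norm (d t)"
      using Cauchy_Schwarz_ineq2[of "vderiv w t" "\<i> * d t"] by (simp add: norm_mult)
    also have "\<dots> \<le> L * B" using dB vw L by (intro mult_mono) auto
    finally have 2: "\<bar>vderiv w t \<bullet> (\<i> * d t)\<bar> \<le> L * B" .
    have "\<bar>k t\<bar> \<le> B * L + L * B"
      unfolding k_def by (rule order_trans[OF abs_triangle_ineq4 add_mono[OF 1 2]])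
    also have "\<dots> = 2 * (L * B)" by (simp add: mult.commute)
    finally show ?thesis .
  qed
  have "integral {0..1} k \<le> integral {0..1} (\<lambda>t::real. 2 * (L * B))"
    by (rule integral_le_ae[OF has_integral_integrable[OF kI] integrable_const_ivl N])
       (rule abs_le_D1[OF bd])
  moreover have "integral {0..1} (\<lambda>t::real. - (2 * (L * B))) \<le> integral {0..1} k"
  proof (rule integral_le_ae[OF integrable_const_ivl has_integral_integrable[OF kI] N])
    show "- (2 * (L * B)) \<le> k t" if "t \<in> {0..1} - (Nu \<union> Nw)" for t
      using abs_le_D2[OF bd[OF that]] by linarith
  qed
  ultimately show ?thesis by (simp add: integral_unique[OF kI])
qed

lemma periodic_bounded:
  fixes u :: "real \<Rightarrow> complex"
  assumes "continuous_on UNIV u" and per: "\<And>t. u (t + 1) = u t"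
  obtains M where "\<And>t. norm (u t) \<le> M"
proof -
  obtain M where M: "\<And>t. t \<in> {0..1} \<Longrightarrow> norm (u t) \<le> M"
    using compact_imp_bounded[OF compact_continuous_image[OF continuous_on_subset[OF assms(1), of "{0..1}"]]]
    by (auto simp: bounded_iff simp del: atLeastAtMost_iff)
  have "norm (u t) \<le> M" for t
  proof -
    have "u t = u (frac t)" using periodic_of_int[of u "frac t" "\<lfloor>t\<rfloor>"] per by (simp add: frac_def)
    then show ?thesis using M[of "frac t"] frac_lt_1[of t] by (simp add: less_imp_le)
  qed
  then show ?thesis using that by blast
qed

lemma continuous_on_difference_quotient:
  fixes u :: "real \<Rightarrow> complex"
  assumes "continuous_on UNIV u"
  shows "continuous_on A (\<lambda>t. (u (t + h) - u t) /\<^sub>R h)"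
proof -
  have "continuous_on UNIV (\<lambda>t. u (t + h))"
    by (rule continuous_on_compose2[OF assms]) (auto intro: continuous_intros)
  then have "continuous_on UNIV (\<lambda>t. (u (t + h) - u t) /\<^sub>R h)"
    using assms by (intro continuous_on_scaleR continuous_on_diff continuous_on_const)
  then show ?thesis by (rule continuous_on_subset) simp
qed

text \<open>Sublinearity bounds \<open>F\<close> at the difference quotients of \<open>v\<close> by averages of \<open>F\<close> along \<open>v'\<close>,
  and the left-hand side is continuous in \<open>v\<close> with respect to uniform convergence.\<close>
lemma difference_quotient_Lagr_le:
  assumes F_cont: "continuous_on UNIV (\<lambda>(p, q). F p q)"
    and F_convex: "\<And>p. convex_on UNIV (F p)"
    and F_hom: "\<And>p q l. l > 0 \<Longrightarrow> F p (l *\<^sub>R q) = l * F p q"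
    and F_bd: "\<And>p q. \<bar>F p q\<bar> \<le> M * norm q"
    and v: "v \<in> W11" "L-lipschitz_on UNIV v"
    and w: "continuous_on UNIV w"
    and h: "0 < h" "h < 1"
    and close: "\<And>s t q. \<lbrakk>t \<le> s; s \<le> t + h; norm q \<le> L\<rbrakk> \<Longrightarrow> F (w t) q \<le> F (v s) q + e"
  shows "integral {0..1} (\<lambda>t. F (w t) ((v (t + h) - v t) /\<^sub>R h)) \<le> Lagr F v + e"
proof -
  have loc_abs_cont: "loc_abs_cont v" and per: "\<And>t. v (t + 1) = v t" using v by (auto simp: W11_iff)
  have F2: "continuous_on A (\<lambda>x. F (f x) (g x))" if "continuous_on A f" "continuous_on A g" for A :: "real set" and f g
    using continuous_on_compose2[OF F_cont, of A "\<lambda>x. (f x, g x)"] that by (simp add: continuous_on_Pair)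
  obtain N where N: "negligible N" "\<And>t. t \<notin> N \<Longrightarrow> (v has_vector_derivative vderiv v t) (at t)"
    using loc_abs_contD(3)[OF loc_abs_cont] by blast
  define G where "G = (\<lambda>s. F (v s) (vderiv v s))"
  have Gi: "G integrable_on {a..b}" for a b
    unfolding G_def using Lagr_integrand_integrable[OF F_cont loc_abs_cont F_bd] set_lebesgue_integral_eq_integral(1) by blast
  have Gper: "G (t + 1) = G t" for t using vderiv_periodic[of v, OF per] per by (simp add: G_def)
  \<comment> \<open>The first argument is frozen at \<open>w t\<close>, so that a single sublinear
    function \<open>F (w t)\<close> is applied to the increment of \<open>v\<close>, which is the
    integral of its derivative.\<close>
  have pt: "F (w t) ((v (t + h) - v t) /\<^sub>R h) \<le> integral {t..t+h} G / h + e" for t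
  proof -
    have "continuous_on UNIV (\<lambda>(p, q). (\<lambda>_. F (w t)) p q)"
      unfolding split_beta by (rule continuous_on_compose2[OF F_cont, of UNIV "\<lambda>x. (w t, snd x)", simplified]) (intro continuous_intros)
    then have Fi: "(\<lambda>s. F (w t) (vderiv v s)) integrable_on {t..t+h}"
      using Lagr_integrand_integrable[of "\<lambda>_. F (w t)" v t "t+h", OF _ loc_abs_cont F_bd] set_lebesgue_integral_eq_integral(1) by blast
    have contF: "continuous_on UNIV (F (w t))"
      by (rule continuous_on_compose2[OF F_cont, of UNIV "\<lambda>q. (w t, q)", simplified]) (intro continuous_intros)
    have "v (t + h) - v t = integral {t..t+h} (vderiv v)"
      using loc_abs_contD(2)[OF loc_abs_cont, of t "t+h"] h by (simp add: integral_unique)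
    then have "F (w t) (v (t + h) - v t) \<le> integral {t..t+h} (\<lambda>s. F (w t) (vderiv v s))"
      using h by (simp add: sublinear_integral_le[OF contF F_convex F_hom vderiv_integrable[OF loc_abs_cont] Fi])
    also have "\<dots> \<le> integral {t..t+h} (\<lambda>s. G s + e)"
    proof (rule integral_le_ae[OF Fi _ N(1)])
      show "(\<lambda>s. G s + e) integrable_on {t..t+h}" by (intro integrable_add Gi) auto
      fix s assume "s \<in> {t..t+h} - N"
      then show "F (w t) (vderiv v s) \<le> G s + e"
        unfolding G_def using norm_vderiv_le_lipschitz[OF v(2) N(2)[of s]] by (intro close) auto
    qed
    also have "\<dots> = integral {t..t+h} G + e * h"
      using Henstock_Kurzweil_Integration.integral_add[OF Gi[of t "t+h"] integrable_const_ivl[of e t "t+h"]] h by simp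
    finally have "F (w t) (v (t + h) - v t) / h \<le> integral {t..t+h} G / h + e"
      using h by (simp add: field_simps)
    then show ?thesis using F_hom[of "inverse h" "w t" "v (t + h) - v t"] h by (simp add: divide_inverse mult.commute)
  qed
  \<comment> \<open>Over a full period the moving averages of \<open>G\<close> have the same
    integral as \<open>G\<close>, which is the energy of \<open>v\<close>.\<close>
  have avg: "((\<lambda>t. integral {t..t+h} G / h + e) has_integral (integral {0..1} G + e)) {0..1}"
    using has_integral_add[OF has_integral_divide[OF integral_average_periodic[OF Gi Gper h], of h] has_integral_const_real[of e 0 1]] h
    by simp
  have vc: "continuous_on A v" for A using loc_abs_contD(4)[OF loc_abs_cont] continuous_on_subset by blast
  have "(\<lambda>t. F (w t) ((v (t + h) - v t) /\<^sub>R h)) integrable_on {0..1}"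
    by (rule integrable_continuous_real[OF F2[OF continuous_on_subset[OF w subset_UNIV]
        continuous_on_difference_quotient[OF vc]]])
  then have "integral {0..1} (\<lambda>t. F (w t) ((v (t + h) - v t) /\<^sub>R h)) \<le> integral {0..1} (\<lambda>t. integral {t..t+h} G / h + e)"
    using avg pt by (intro integral_le) auto
  also have "\<dots> = Lagr F v + e" using integral_unique[OF avg] by (simp add: Lagr_def G_def)
  finally show ?thesis .
qed

text \<open>For a fixed step h the difference quotients of \<open>v n\<close> converge pointwise to
  those of \<open>w\<close>, which gives the bound \<open>c + e\<close> for the quotients of
  \<open>w\<close>. Only then does h tend to 0, where these quotients converge to the derivative of
  \<open>w\<close> almost everywhere. Both limits are dominated by the constant
  \<open>M * L\<close>.\<close>

lemma Lagr_lower_semicontinuous: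
  assumes F_cont: "continuous_on UNIV (\<lambda>(p, q). F p q)"
    and F_convex: "\<And>p. convex_on UNIV (F p)"
    and F_hom: "\<And>p q l. l > 0 \<Longrightarrow> F p (l *\<^sub>R q) = l * F p q"
    and F_bd: "\<And>p q. \<bar>F p q\<bar> \<le> M * norm q"
    and v: "\<And>n. v n \<in> W11" "\<And>n. L-lipschitz_on UNIV (v n)"
    and w: "w \<in> W11" "L-lipschitz_on UNIV w"
    and lim: "uniform_limit UNIV v w sequentially"
    and c: "(\<lambda>n. Lagr F (v n)) \<longlonglongrightarrow> c"
  shows "Lagr F w \<le> c"
proof (rule field_le_epsilon)
  fix e :: real assume e: "e > 0"
  have L: "0 \<le> L" using w lipschitz_on_nonneg by blast
  have M: "0 \<le> M" using F_bd[of 0 1] by simp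
  have loc_abs_cont: "loc_abs_cont w" and per: "\<And>t. w (t + 1) = w t" using w by (auto simp: W11_iff)
  have F2: "continuous_on A (\<lambda>x. F (f x) (g x))" if "continuous_on A f" "continuous_on A g" for A :: "real set" and f g
    using continuous_on_compose2[OF F_cont, of A "\<lambda>x. (f x, g x)"] that by (simp add: continuous_on_Pair)
  have FT: "(\<lambda>n. F p (q n)) \<longlonglongrightarrow> F p q'" if "q \<longlonglongrightarrow> q'" for p q q'
    using continuous_on_tendsto_compose[OF F_cont, of "\<lambda>n. (p, q n)" "(p, q')"] that by (simp add: tendsto_Pair)
  have wc: "continuous_on A w" for A by (rule continuous_on_subset[OF loc_abs_contD(4)[OF loc_abs_cont] subset_UNIV])
  have vc: "continuous_on A (v n)" for A n
    using v(1)[of n] by (auto simp: W11_iff intro: continuous_on_subset[OF loc_abs_contD(4)])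
  obtain R where R: "\<And>t. norm (w t) \<le> R" using periodic_bounded[OF wc per] by blast
  \<comment> \<open>The radius \<open>R + 1\<close> accommodates \<open>w\<close> and every
    \<open>v n\<close> within distance 1 of it; \<open>L\<close> bounds the second argument.\<close>
  have "compact (cball 0 (R + 1) \<times> cball 0 L :: (complex \<times> complex) set)" by (intro compact_Times compact_cball)
  then have "uniformly_continuous_on (cball 0 (R + 1) \<times> cball 0 L) (\<lambda>(p, q). F p q)"
    by (intro compact_uniformly_continuous continuous_on_subset[OF F_cont]) auto
  then obtain d where "d > 0" and d0: "\<And>x x'. \<lbrakk>x \<in> cball 0 (R + 1) \<times> cball 0 L; x' \<in> cball 0 (R + 1) \<times> cball 0 L; dist x' x < d\<rbrakk>
      \<Longrightarrow> dist (case x' of (p, q) \<Rightarrow> F p q) (case x of (p, q) \<Rightarrow> F p q) < e"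
    using e unfolding uniformly_continuous_on_def by meson
  have d: "d > 0" "\<lbrakk>norm p \<le> R + 1; norm q \<le> L; norm p' \<le> R + 1; norm q' \<le> L; dist (p', q') (p, q) < d\<rbrakk>
      \<Longrightarrow> dist (F p' q') (F p q) < e" for p q p' q'
    using \<open>d > 0\<close> d0[of "(p, q)" "(p', q')"] by simp_all
  \<comment> \<open>During a time h at most \<open>h0\<close> the curve \<open>w\<close> moves by
    less than d/2, and \<open>v n\<close> is within d/2 of \<open>w\<close>. So \<open>v n s\<close>
    and \<open>w t\<close> are within \<open>d\<close>, as uniform continuity requires. The cap 1/2
    ensures h < 1.\<close>
  define h0 where "h0 = min (1/2) (d / (2 * (L + 1)))"
  have h0: "h0 > 0" "h0 < 1" using d L by (auto simp: h0_def)
  have Lh: "L * h < d / 2" if "0 < h" "h \<le> h0" for h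
  proof -
    have "L * h < (L + 1) * h" using that by simp
    also have "\<dots> \<le> (L + 1) * (d / (2 * (L + 1)))" using that L by (intro mult_left_mono) (auto simp: h0_def)
    also have "\<dots> = d / 2" using L by (simp add: field_simps)
    finally show ?thesis .
  qed
  have qb: "\<bar>F p ((u (t + h) - u t) /\<^sub>R h)\<bar> \<le> M * L" if "L-lipschitz_on UNIV u" for u :: "real \<Rightarrow> complex" and p t h
    using order_trans[OF F_bd mult_left_mono[OF norm_difference_quotient_le[OF that] M]] .
  have fixed_h: "integral {0..1} (\<lambda>t. F (w t) ((w (t + h) - w t) /\<^sub>R h)) \<le> c + e" if h: "0 < h" "h \<le> h0" for h
  proof -
    have h1: "h < 1" using h h0 by simp
    have "\<forall>\<^sub>F n in sequentially. \<forall>t\<in>UNIV. dist (v n t) (w t) < min 1 (d / 2)"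
      using lim d(1) by (intro uniform_limitD) auto
    then have ev: "\<forall>\<^sub>F n in sequentially. integral {0..1} (\<lambda>t. F (w t) ((v n (t + h) - v n t) /\<^sub>R h)) \<le> Lagr F (v n) + e"
    proof (rule eventually_mono)
      fix n assume n: "\<forall>t\<in>UNIV. dist (v n t) (w t) < min 1 (d / 2)"
      show "integral {0..1} (\<lambda>t. F (w t) ((v n (t + h) - v n t) /\<^sub>R h)) \<le> Lagr F (v n) + e"
      proof (rule difference_quotient_Lagr_le[OF F_cont F_convex F_hom F_bd v wc h(1) h1])
        fix s t :: real and q :: complex assume st: "t \<le> s" "s \<le> t + h" and q: "norm q \<le> L"
        have "norm (v n s) \<le> R + 1"
          using R[of s] n[rule_format, of s] norm_triangle_ineq[of "w s" "v n s - w s"] by (simp add: dist_norm)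
        moreover have "dist (v n s) (w t) < d"
        proof -
          have "dist (w s) (w t) \<le> L * h"
            using lipschitz_onD[OF w(2), of s t] mult_left_mono[of "s - t" h L] st L by (simp add: dist_real_def)
          then show ?thesis
            using dist_triangle[of "v n s" "w t" "w s"] Lh[OF h] n[rule_format, of s] by simp
        qed
        ultimately have "dist (F (w t) q) (F (v n s) q) < e"
          using d(2)[of "v n s" q "w t" q] R[of t] q by (simp add: dist_Pair_Pair dist_commute)
        then show "F (w t) q \<le> F (v n s) q + e" by (simp add: dist_real_def abs_less_iff)
      qed
    qed
    have "(\<lambda>n. integral {0..1} (\<lambda>t. F (w t) ((v n (t + h) - v n t) /\<^sub>R h))) \<longlonglongrightarrow> integral {0..1} (\<lambda>t. F (w t) ((w (t + h) - w t) /\<^sub>R h))"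
    proof (rule dominated_convergence(2)[where h = "\<lambda>_. M * L"])
      show "(\<lambda>t. F (w t) ((v n (t + h) - v n t) /\<^sub>R h)) integrable_on {0..1}" for n
        by (rule integrable_continuous_real[OF F2[OF wc continuous_on_difference_quotient[OF vc]]])
      show "norm (F (w t) ((v n (t + h) - v n t) /\<^sub>R h)) \<le> M * L" for n t using qb[OF v(2)] by simp
      show "(\<lambda>n. F (w t) ((v n (t + h) - v n t) /\<^sub>R h)) \<longlonglongrightarrow> F (w t) ((w (t + h) - w t) /\<^sub>R h)" for t
        using tendsto_uniform_limitI[OF lim UNIV_I] by (intro FT tendsto_scaleR tendsto_diff tendsto_const)
    qed auto
    then show ?thesis using c ev by (intro tendsto_le[OF _ tendsto_add[OF c tendsto_const]]) auto
  qed
  obtain N where N: "negligible N" "\<And>t. t \<notin> N \<Longrightarrow> (w has_vector_derivative vderiv w t) (at t)"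
    using loc_abs_contD(3)[OF loc_abs_cont] by blast
  \<comment> \<open>Dominated convergence is applied with convergence at every point of the domain,
    so the points where \<open>w\<close> is not differentiable are removed first.\<close>
  define S where "S = {0..1} - N"
  have S: "integral S f = integral {0..1} f" for f :: "real \<Rightarrow> real"
    by (rule integral_spike_set) (auto simp: S_def intro: negligible_subset[OF N(1)])
  have Si: "f integrable_on S" if "f integrable_on {0..1}" for f :: "real \<Rightarrow> real"
    using integrable_spike_set[OF that, of S] by (auto simp: S_def intro: negligible_subset[OF N(1)])
  define hn where "hn n = h0 * inverse (real (Suc n))" for n
  have hn: "0 < hn n" "hn n \<le> h0" for n using h0 by (auto simp: hn_def divide_simps)
  have hn0: "hn \<longlonglongrightarrow> 0" unfolding hn_def
    using tendsto_mult[OF tendsto_const[of h0] LIMSEQ_inverse_real_of_nat] by simp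
  then have hn_at: "filterlim hn (at 0) sequentially" using hn(1) by (simp add: filterlim_at less_imp_neq[THEN not_sym])
  have "(\<lambda>n. integral S (\<lambda>t. F (w t) ((w (t + hn n) - w t) /\<^sub>R hn n))) \<longlonglongrightarrow> integral S (\<lambda>t. F (w t) (vderiv w t))"
  proof (rule dominated_convergence(2)[where h = "\<lambda>_. M * L"])
    show "(\<lambda>t. F (w t) ((w (t + hn n) - w t) /\<^sub>R hn n)) integrable_on S" for n
      by (rule Si[OF integrable_continuous_real[OF F2[OF wc continuous_on_difference_quotient[OF wc]]]])
    show "(\<lambda>_. M * L) integrable_on S" by (intro Si) auto
    show "norm (F (w t) ((w (t + hn n) - w t) /\<^sub>R hn n)) \<le> M * L" for n t using qb[OF w(2)] by simp
    show "(\<lambda>n. F (w t) ((w (t + hn n) - w t) /\<^sub>R hn n)) \<longlonglongrightarrow> F (w t) (vderiv w t)" if "t \<in> S" for t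
      using filterlim_compose[OF difference_quotient_tendsto[OF N(2)[of t]] hn_at] that by (intro FT) (auto simp: S_def)
  qed
  then have "(\<lambda>n. integral {0..1} (\<lambda>t. F (w t) ((w (t + hn n) - w t) /\<^sub>R hn n))) \<longlonglongrightarrow> Lagr F w"
    by (simp add: S Lagr_def)
  then show "Lagr F w \<le> c + e"
    by (rule LIMSEQ_le_const2) (use fixed_h[OF hn] in auto)
qed

section \<open>Existence of minimizers\<close>

text \<open>The witness is a circle enclosing area \<bar>\<tau>\<bar>, run through once, or a
  constant if \<tau> = 0. Since u \<bullet> (i u') = -k r^2, counterclockwise circles have negative
  \<open>area\<close>, hence the minus sign in \<open>k\<close>. Nonemptiness is what gives the
  real-valued \<open>Inf\<close> in \<open>Sval\<close> its meaning.\<close>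

lemma Mset_nonempty: "Mset \<tau> \<noteq> {}"
proof -
  define r where "r = sqrt (\<bar>\<tau>\<bar> / pi)"
  define k where "k = - sgn \<tau> * (2 * pi)"
  define u where "u t = complex_of_real r * cis (k * t)" for t
  define v where "v t = complex_of_real r * (\<i> * complex_of_real k * cis (k * t))" for t
  have der: "(u has_vector_derivative v t) (at t within S)" for t S
  proof -
    have "((\<lambda>t. cis (k * t)) has_derivative (\<lambda>x. (k * x) *\<^sub>R (\<i> * cis (k * t)))) (at t within S)"
      by (rule has_derivative_cis) (auto intro!: derivative_eq_intros)
    then have "((\<lambda>t. cis (k * t)) has_vector_derivative (\<i> * complex_of_real k * cis (k * t))) (at t within S)"
      by (simp add: has_vector_derivative_def scaleR_conv_of_real mult_ac)
    then show ?thesis unfolding u_def v_def by (rule has_vector_derivative_mult_right)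
  qed
  have vd: "vderiv u t = v t" for t by (rule vector_derivative_at[OF der])
  have "continuous_on A v" for A unfolding v_def by (intro continuous_intros)
  then have "v absolutely_integrable_on {a..b}" for a b by (rule absolutely_integrable_continuous_real)
  moreover have "u b - u a = integral {a..b} v" if "a \<le> b" for a b
    using integral_unique[OF fundamental_theorem_of_calculus[OF that der]] by simp
  ultimately have "loc_abs_cont u" unfolding loc_abs_cont_def by blast
  moreover have "u (t + 1) = u t" for t
  proof -
    have "cis k = 1" by (simp add: k_def cis.ctr complex_eq_iff sgn_real_def)
    then show ?thesis by (simp add: u_def distrib_left cis_mult[symmetric])
  qed
  ultimately have "u \<in> W11" by (simp add: W11_iff)
  moreover have "area u = \<tau>"
  proof -
    have "u t \<bullet> (\<i> * v t) = - k * r\<^sup>2" for t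
    proof -
      have "\<i> * v t = (- k) *\<^sub>R u t" by (simp add: u_def v_def scaleR_conv_of_real mult_ac)
      then show ?thesis by (simp add: dot_square_norm u_def norm_mult)
    qed
    then have "area u = - k * r\<^sup>2 / 2" by (simp add: area_def vd)
    also have "\<dots> = \<tau>" by (simp add: k_def r_def sgn_mult_abs)
    finally show ?thesis .
  qed
  ultimately show ?thesis by (auto simp: Mset_def)
qed

lemma Mset_lipschitz_reparametrization:
  assumes F_cont: "continuous_on UNIV (\<lambda>(p, q). F p q)"
    and F_hom: "\<And>p q l. l > 0 \<Longrightarrow> F p (l *\<^sub>R q) = l * F p q"
    and F_bd: "\<And>p q. \<bar>F p q\<bar> \<le> M * norm q"
    and u: "u \<in> Mset \<tau>"
  obtains w where "w \<in> Mset \<tau>" "(integral {0..1} (\<lambda>t. norm (vderiv u t)) + 1)-lipschitz_on UNIV w"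
    "Lagr F w = Lagr F u"
proof -
  have uW: "u \<in> W11" "area u = \<tau>" and loc_abs_cont: "loc_abs_cont u" using u by (auto simp: Mset_def W11_iff)
  obtain w where w: "w \<in> W11" "(integral {0..1} (\<lambda>t. norm (vderiv u t)) + 1)-lipschitz_on UNIV w"
    and G: "\<And>G. \<lbrakk>\<And>p q l. l > 0 \<Longrightarrow> G p (l *\<^sub>R q) = l * G p q;
           (\<lambda>t. G (u t) (vderiv u t)) absolutely_integrable_on {0..1}\<rbrakk> \<Longrightarrow> Lagr G w = Lagr G u"
    using lipschitz_reparametrization[OF uW(1)] by blast
  have "Lagr (\<lambda>p q. p \<bullet> (\<i> * q)) w = Lagr (\<lambda>p q. p \<bullet> (\<i> * q)) u"
    by (rule G) (use area_integrable[OF loc_abs_cont] in simp_all)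
  then have "w \<in> Mset \<tau>" using uW w by (simp add: Mset_def area_eq_Lagr)
  moreover have "Lagr F w = Lagr F u"
    using Lagr_integrand_integrable[OF F_cont loc_abs_cont F_bd] by (intro G F_hom) auto
  ultimately show ?thesis using w that by blast
qed

lemma Sval_le_Lagr:
  assumes "\<And>p q. 0 \<le> F p q" "u \<in> Mset \<tau>"
  shows "Sval F \<tau> \<le> Lagr F u"
  unfolding Sval_def
proof (rule cInf_lower)
  show "bdd_below (Lagr F ` Mset \<tau>)"
  proof (rule bdd_belowI2)
    \<comment> \<open>If the integrand is not integrable, the integral is 0 by convention and the
      bound still holds.\<close>
    show "0 \<le> Lagr F v" for v
      unfolding Lagr_def by (cases "(\<lambda>t. F (v t) (vderiv v t)) integrable_on {0..1}")
        (auto intro: integral_nonneg simp: assms not_integrable_integral)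
  qed
qed (use assms in simp)

text \<open>Convexity at the midpoint of b and a - b, combined with homogeneity, is subadditivity: f
  a \<le> f b + f (a - b). For \<open>F p\<close> the resulting Lipschitz constant does not depend
  on \<open>p\<close>, and this is what upgrades convergence at each \<open>q\<close> to convergence
  uniform in bounded \<open>q\<close>.\<close>

lemma sublinear_diff_le:
  fixes f :: "complex \<Rightarrow> real"
  assumes conv: "convex_on UNIV f" and hom: "\<And>l q. l > 0 \<Longrightarrow> f (l *\<^sub>R q) = l * f q"
    and bd: "\<And>q. f q \<le> M * norm q"
  shows "\<bar>f x - f y\<bar> \<le> M * norm (x - y)"
proof -
  have "f a \<le> f b + f (a - b)" for a b
  proof -
    have "f ((1 - 1/2) *\<^sub>R b + (1/2) *\<^sub>R (a - b)) \<le> (1 - 1/2) * f b + (1/2) * f (a - b)"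
      by (rule convex_onD[OF conv]) auto
    moreover have "(1 - 1/2) *\<^sub>R b + (1/2) *\<^sub>R (a - b) = (1/2) *\<^sub>R a" by (simp add: scaleR_diff_right)
    ultimately show ?thesis using hom[of "1/2" a] by simp
  qed
  from this[of x y] this[of y x] show ?thesis
    using bd[of "x - y"] bd[of "y - x"] by (simp add: abs_le_iff norm_minus_commute)
qed

theorem theorem1p2p2:
  fixes F Finf :: "complex \<Rightarrow> complex \<Rightarrow> real" and m1 m2 :: real
  assumes F_cont: "continuous_on UNIV (\<lambda>(p, q). F p q)"
    and F_convex: "\<And>p. convex_on UNIV (F p)"
    and F_hom: "\<And>p q (l::real). l > 0 \<Longrightarrow> F p (l *\<^sub>R q) = l * F p q"
    and m_pos: "m1 > 0" "m2 > 0"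
    and F_bounds: "\<And>p q. m1 * norm q \<le> F p q \<and> F p q \<le> m2 * norm q"
    and Finf_cont: "continuous_on UNIV (\<lambda>(p, q). Finf p q)"
    and Finf_per: "\<And>p q (a::int) (b::int). Finf (p + Complex (of_int a) (of_int b)) q = Finf p q"
    and F_lim: "\<And>q. ((\<lambda>p. F p q - Finf p q) \<longlongrightarrow> 0) at_infinity"
  shows "(\<forall>\<tau>. Sval F \<tau> \<le> Sval Finf \<tau>) \<and>
         (\<forall>\<tau>. Sval F \<tau> < Sval Finf \<tau> \<longrightarrow>
            (\<exists>u. u \<in> Mset \<tau> \<and> (\<exists>L. L-lipschitz_on UNIV u) \<and> Lagr F u = Sval F \<tau>))"
proof -
  have F0: "0 \<le> F p q" for p q using F_bounds[of q p] m_pos order_trans[of 0 "m1 * norm q"] by simp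
  have F_bd: "\<bar>F p q\<bar> \<le> m2 * norm q" for p q using F0[of p q] F_bounds[of q p] by simp
  have F_lip: "\<bar>F p x - F p y\<bar> \<le> m2 * norm (x - y)" for p x y
    using sublinear_diff_le[OF F_convex F_hom] F_bounds by blast
  \<comment> \<open>Translating by (n, 0) leaves \<open>Finf\<close> unchanged and makes
    \<open>F\<close> converge to it. So \<open>Finf\<close> inherits from \<open>F\<close>
    nonnegativity, linear growth and the Lipschitz bound in \<open>q\<close>.\<close>
  have tr: "(\<lambda>n. F (p + of_nat n) q) \<longlonglongrightarrow> Finf p q" for p q
  proof -
    have "filterlim (\<lambda>n. p + of_nat n) at_infinity sequentially"
      by (intro tendsto_add_filterlim_at_infinity[OF tendsto_const] tendsto_of_nat)
    from filterlim_compose[OF F_lim this, of q]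
    have "(\<lambda>n. F (p + of_nat n) q - Finf (p + of_nat n) q) \<longlonglongrightarrow> 0" .
    moreover have "Finf (p + of_nat n) q = Finf p q" for n
    proof -
      have "(of_nat n :: complex) = Complex (of_int (int n)) (of_int 0)" by (simp add: complex_eq_iff)
      then show ?thesis using Finf_per[of p "int n" 0 q] by simp
    qed
    ultimately show ?thesis by (simp add: LIM_zero_iff)
  qed
  have Finf0: "0 \<le> Finf p q" for p q using tr F0 by (intro LIMSEQ_le_const[OF tr]) auto
  have Finf_bd: "\<bar>Finf p q\<bar> \<le> m2 * norm q" for p q
    using Finf0[of p q] LIMSEQ_le_const2[OF tr[of p q], of "m2 * norm q"] F_bounds by auto
  have Finf_lip: "\<bar>Finf p x - Finf p y\<bar> \<le> m2 * norm (x - y)" for p x y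
    by (rule LIMSEQ_le_const2[OF tendsto_rabs[OF tendsto_diff[OF tr[of p x] tr[of p y]]]]) (use F_lip in auto)
  have le: "Sval F \<tau> \<le> Sval Finf \<tau>" for \<tau>
    unfolding Sval_def[of Finf]
  proof (rule cInf_greatest)
    show "Lagr Finf ` Mset \<tau> \<noteq> {}" using Mset_nonempty by simp
    fix x assume "x \<in> Lagr Finf ` Mset \<tau>"
    then obtain u where u: "u \<in> Mset \<tau>" and x: "x = Lagr Finf u" by auto
    have loc_abs_cont: "loc_abs_cont u" using u by (simp add: Mset_def W11_iff)
    have eq: "Lagr F (\<lambda>t. u t + of_nat n) = integral {0..1} (\<lambda>t. F (u t + of_nat n) (vderiv u t))" for n
      by (simp add: Lagr_def vderiv_translate)
    \<comment> \<open>The curve is fixed here, so pointwise convergence and the dominating function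
      m2 \<bar>u'\<bar> suffice. For curves that vary with n, the uniform statement
      \<open>unif\<close> takes over.\<close>
    have "(\<lambda>n. integral {0..1} (\<lambda>t. F (u t + of_nat n) (vderiv u t))) \<longlonglongrightarrow> integral {0..1} (\<lambda>t. Finf (u t) (vderiv u t))"
    proof (rule dominated_convergence(2)[where h = "\<lambda>t. m2 * norm (vderiv u t)"])
      show "(\<lambda>t. F (u t + of_nat n) (vderiv u t)) integrable_on {0..1}" for n
        using Lagr_integrand_integrable[OF F_cont loc_abs_cont_translate[OF loc_abs_cont] F_bd, of 0 1 "of_nat n"] set_lebesgue_integral_eq_integral(1)
        by (auto simp: vderiv_translate)
      show "(\<lambda>t. m2 * norm (vderiv u t)) integrable_on {0..1}"
        by (intro integrable_on_mult_right norm_vderiv_integrable loc_abs_cont)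
    qed (use F_bd tr in auto)
    then have "(\<lambda>n. Lagr F (\<lambda>t. u t + of_nat n)) \<longlonglongrightarrow> x" unfolding eq x Lagr_def[of Finf] .
    then show "Sval F \<tau> \<le> x"
      by (rule LIMSEQ_le_const) (use Sval_le_Lagr[of F, OF F0 translate_in_Mset[OF u]] in auto)
  qed
  have unif: "\<exists>R. \<forall>p q. R \<le> norm p \<longrightarrow> norm q \<le> L \<longrightarrow> \<bar>F p q - Finf p q\<bar> \<le> e" if e: "e > 0" for L e
  proof -
    \<comment> \<open>For an \<eta>-net of the ball of radius \<open>L\<close>, moving
      \<open>q\<close> to a net point costs e/3 for \<open>F\<close> and e/3 for
      \<open>Finf\<close>. At the finitely many net points the difference is below e/3 far
      out.\<close>
    define \<eta> where "\<eta> = e / (3 * m2)"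
    have \<eta>: "\<eta> > 0" "m2 * \<eta> = e / 3" using e m_pos by (auto simp: \<eta>_def)
    obtain k where k: "finite k" "cball (0::complex) L \<subseteq> (\<Union>x\<in>k. ball x \<eta>)"
      using compact_cball[of "0::complex" L, unfolded compact_eq_totally_bounded] \<eta> by blast
    have "\<forall>\<^sub>F p in at_infinity. \<forall>x\<in>k. dist (F p x - Finf p x) 0 < e / 3"
      using e by (intro eventually_ball_finite k ballI tendstoD[OF F_lim]) auto
    then obtain R where R: "\<And>p x. R \<le> norm p \<Longrightarrow> x \<in> k \<Longrightarrow> \<bar>F p x - Finf p x\<bar> < e / 3"
      by (auto simp: eventually_at_infinity)
    have "\<bar>F p q - Finf p q\<bar> \<le> e" if p: "R \<le> norm p" and q: "norm q \<le> L" for p q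
    proof -
      obtain x where x: "x \<in> k" "norm (q - x) < \<eta>" using k(2) q by (auto simp: dist_norm norm_minus_commute)
      have "m2 * norm (q - x) \<le> e / 3" using mult_left_mono[of "norm (q - x)" \<eta> m2] x \<eta> m_pos by simp
      then show ?thesis using F_lip[of p q x] Finf_lip[of p q x] R[OF p x(1)] by linarith
    qed
    then show ?thesis by blast
  qed
  have "\<exists>u. u \<in> Mset \<tau> \<and> (\<exists>L. L-lipschitz_on UNIV u) \<and> Lagr F u = Sval F \<tau>"
    if gap: "Sval F \<tau> < Sval Finf \<tau>" for \<tau>
  proof -
    define s where "s = Sval F \<tau>"
    \<comment> \<open>Curves of energy at most s + 1 have length at most (s + 1) / m1; the final 1
      is the one added to the length in \<open>lipschitz_reparametrization\<close>.\<close>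
    define L where "L = (s + 1) / m1 + 1"
    have "\<exists>w. w \<in> Mset \<tau> \<and> L-lipschitz_on UNIV w \<and> Lagr F w < s + inverse (real (Suc n))" for n
    proof -
      have "s < s + inverse (real (Suc n))" by simp
      then obtain u where u: "u \<in> Mset \<tau>" "Lagr F u < s + inverse (real (Suc n))"
        using cInf_lessD[of "Lagr F ` Mset \<tau>"] Mset_nonempty[of \<tau>] unfolding s_def Sval_def by force
      have loc_abs_cont: "loc_abs_cont u" using u by (simp add: Mset_def W11_iff)
      obtain w where w: "w \<in> Mset \<tau>" "(integral {0..1} (\<lambda>t. norm (vderiv u t)) + 1)-lipschitz_on UNIV w"
          "Lagr F w = Lagr F u"
        using Mset_lipschitz_reparametrization[OF F_cont F_hom F_bd u(1)] by blast
      have "inverse (real (Suc n)) \<le> 1" by (simp add: field_simps)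
      then have "Lagr F u \<le> s + 1" using u(2) by linarith
      moreover have "m1 * integral {0..1} (\<lambda>t. norm (vderiv u t)) \<le> Lagr F u"
      proof -
        have "integral {0..1} (\<lambda>t. m1 * norm (vderiv u t)) \<le> integral {0..1} (\<lambda>t. F (u t) (vderiv u t))"
          using F_bounds Lagr_integrand_integrable[OF F_cont loc_abs_cont F_bd]
          by (intro integral_le integrable_on_mult_right norm_vderiv_integrable loc_abs_cont set_lebesgue_integral_eq_integral(1)) auto
        then show ?thesis by (simp add: Lagr_def)
      qed
      ultimately have "integral {0..1} (\<lambda>t. norm (vderiv u t)) + 1 \<le> L"
        using m_pos by (simp add: L_def field_simps)
      then show ?thesis using w u lipschitz_on_le by metis
    qed
    then obtain v where v: "\<And>n. v n \<in> Mset \<tau>" "\<And>n. L-lipschitz_on UNIV (v n)" "\<And>n. Lagr F (v n) < s + inverse (real (Suc n))"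
      by metis
    have L: "0 \<le> L" using v(2) lipschitz_on_nonneg by blast
    have vW: "v n \<in> W11" and v_area: "area (v n) = \<tau>" and v_lac: "loc_abs_cont (v n)" and v_per: "v n (t + 1) = v n t" for n t
      using v(1)[of n] by (auto simp: Mset_def W11_iff)
    have v_lim: "(\<lambda>n. Lagr F (v n)) \<longlonglongrightarrow> s"
    proof (rule tendsto_sandwich[OF _ _ tendsto_const])
      show "\<forall>\<^sub>F n in sequentially. s \<le> Lagr F (v n)"
        using Sval_le_Lagr[of F, OF F0 v(1)] by (simp add: s_def)
      show "\<forall>\<^sub>F n in sequentially. Lagr F (v n) \<le> s + inverse (real (Suc n))"
        using v(3) by (simp add: less_imp_le)
      show "(\<lambda>n. s + inverse (real (Suc n))) \<longlonglongrightarrow> s"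
        using tendsto_add[OF tendsto_const[of s] LIMSEQ_inverse_real_of_nat] by simp
    qed
    \<comment> \<open>Half the gap: one \<delta> bounds the excess of the energy over
      \<open>s\<close>, the other the difference between the two energies, and s + 2 \<delta> is
      exactly \<open>Sval Finf \<tau>\<close>.\<close>
    define \<delta> where "\<delta> = (Sval Finf \<tau> - s) / 2"
    have \<delta>: "\<delta> > 0" using gap by (simp add: \<delta>_def s_def)
    obtain R where R: "\<And>p q. R \<le> norm p \<Longrightarrow> norm q \<le> L \<Longrightarrow> \<bar>F p q - Finf p q\<bar> \<le> \<delta>"
      using unif[OF \<delta>, of L] by blast
    have v_osc: "norm (v n x - v n y) \<le> L * \<bar>x - y\<bar>" for n x y
      using lipschitz_onD[OF v(2), of x y n] by (simp add: dist_norm)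
    \<comment> \<open>A curve far away from the origin has almost the same \<open>F\<close>- and \<open>Finf\<close>-energies, which the gap forbids.\<close>
    have v_near: "norm (v n 0) < R + L" if n: "Lagr F (v n) < s + \<delta>" for n
    proof (rule ccontr)
      assume "\<not> norm (v n 0) < R + L"
      \<comment> \<open>Within one period the curve moves by at most \<open>L\<close>, so the margin
        \<open>L\<close> keeps all of it at distance at least \<open>R\<close> from the
        origin.\<close>
      then have far: "R \<le> norm (v n t)" if "t \<in> {0..1}" for t
        using v_osc[of n 0 t] norm_triangle_ineq2[of "v n 0" "v n t"] mult_left_mono[of t 1 L] L that by simp
      obtain N where N: "negligible N" "\<And>t. t \<notin> N \<Longrightarrow> (v n has_vector_derivative vderiv (v n) t) (at t)"
        using loc_abs_contD(3)[OF v_lac] by blast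
      have Fi: "(\<lambda>t. F (v n t) (vderiv (v n) t)) integrable_on {0..1}"
        using Lagr_integrand_integrable[OF F_cont v_lac F_bd] set_lebesgue_integral_eq_integral(1) by blast
      have "Lagr Finf (v n) \<le> integral {0..1} (\<lambda>t. F (v n t) (vderiv (v n) t) + \<delta>)"
        unfolding Lagr_def
      proof (rule integral_le_ae[OF _ _ N(1)])
        show "(\<lambda>t. Finf (v n t) (vderiv (v n) t)) integrable_on {0..1}"
          using Lagr_integrand_integrable[OF Finf_cont v_lac Finf_bd] set_lebesgue_integral_eq_integral(1) by blast
        show "(\<lambda>t. F (v n t) (vderiv (v n) t) + \<delta>) integrable_on {0..1}"
          by (intro integrable_add Fi integrable_const_ivl)
        fix t assume t: "t \<in> {0..1} - N"
        then have "norm (vderiv (v n) t) \<le> L" by (intro norm_vderiv_le_lipschitz[OF v(2) N(2)]) auto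
        with R[OF far[of t] this] t show "Finf (v n t) (vderiv (v n) t) \<le> F (v n t) (vderiv (v n) t) + \<delta>"
          by (auto simp: abs_le_iff)
      qed
      also have "\<dots> = Lagr F (v n) + \<delta>"
        using Henstock_Kurzweil_Integration.integral_add[OF Fi integrable_const_ivl[of \<delta> 0 1]] by (simp add: Lagr_def)
      also have "\<dots> < Sval Finf \<tau>" using n by (simp add: \<delta>_def field_simps)
      finally show False using Sval_le_Lagr[of Finf, OF Finf0 v(1)[of n]] by simp
    qed
    obtain n0 where n0: "\<And>n. n \<ge> n0 \<Longrightarrow> Lagr F (v n) < s + \<delta>"
      using order_tendstoD(2)[OF v_lim, of "s + \<delta>"] \<delta> by (auto simp: eventually_sequentially)
    \<comment> \<open>Dropping the first \<open>n0\<close> terms leaves only curves to which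
      \<open>v_near\<close> applies. They start within \<open>R + L\<close> of the origin and move
      by at most \<open>L\<close>, whence the common bound \<open>R + 2 * L\<close>.\<close>
    define y where "y n = v (n + n0)" for n
    have "norm (y n t) \<le> R + 2 * L" if "t \<in> {0..1}" for n t
      using v_near[OF n0[of "n + n0"]] v_osc[of "n + n0" t 0] norm_triangle_ineq2[of "v (n + n0) t" "v (n + n0) 0"]
        mult_left_mono[of t 1 L] L that by (simp add: y_def)
    moreover have "\<exists>d>0. \<forall>n y'. y' \<in> {0..1} \<and> norm (x - y') < d \<longrightarrow> norm (y n x - y n y') < e"
      if "x \<in> {0..1}" "0 < e" for x e :: real
    proof (intro exI[of _ "e / (L + 1)"] conjI allI impI)
      fix n y' assume "y' \<in> {0..1} \<and> norm (x - y') < e / (L + 1)"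
      then have "(L + 1) * \<bar>x - y'\<bar> < e" using L by (simp add: field_simps)
      then show "norm (y n x - y n y') < e"
        using v_osc[of "n + n0" x y'] abs_ge_zero[of "x - y'"] unfolding y_def distrib_right mult_1 by linarith
    qed (use L that in auto)
    ultimately obtain g k where k: "strict_mono (k :: nat \<Rightarrow> nat)"
      and g: "\<And>e. 0 < e \<Longrightarrow> \<exists>N. \<forall>n x. n \<ge> N \<and> x \<in> {0..1} \<longrightarrow> norm (y (k n) x - g x) < e"
      using Arzela_Ascoli[OF compact_Icc[of 0 "1::real"], of y "R + 2 * L"] by metis
    define j where "j n = k n + n0" for n
    \<comment> \<open>Arzela-Ascoli provides a limit on the unit interval only. Every
      \<open>v n\<close> is determined by its values at fractional parts, so the periodic extension
      is a uniform limit on the whole line.\<close>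
    define w where "w t = g (frac t)" for t
    have vj_frac: "v n t = v n (frac t)" for n t
      using periodic_of_int[of "v n" "frac t" "\<lfloor>t\<rfloor>"] v_per by (simp add: frac_def)
    have frac_in: "frac t \<in> {0..1}" for t :: real using frac_lt_1[of t] by (simp add: less_imp_le)
    have lim: "uniform_limit UNIV (\<lambda>n. v (j n)) w sequentially"
      unfolding uniform_limit_iff eventually_sequentially
    proof (intro allI impI)
      fix e :: real assume "e > 0"
      then obtain N where N: "\<forall>n x. n \<ge> N \<and> x \<in> {0..1} \<longrightarrow> norm (y (k n) x - g x) < e" using g by blast
      have "dist (v (j n) t) (w t) < e" if "n \<ge> N" for n t
        using N[rule_format, of n "frac t"] that frac_in[of t] vj_frac[of "j n" t]
        by (simp add: dist_norm w_def j_def y_def)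
      then show "\<exists>N. \<forall>n\<ge>N. \<forall>x\<in>UNIV. dist (v (j n) x) (w x) < e" by blast
    qed
    have w_lip: "L-lipschitz_on UNIV w"
    proof (rule lipschitz_onI)
      fix a b :: real
      have "(\<lambda>n. dist (v (j n) a) (v (j n) b)) \<longlonglongrightarrow> dist (w a) (w b)"
        by (intro tendsto_dist tendsto_uniform_limitI[OF lim] UNIV_I)
      then show "dist (w a) (w b) \<le> L * dist a b"
        by (rule LIMSEQ_le_const2) (use lipschitz_onD[OF v(2)] in auto)
    qed (rule L)
    have w_W: "w \<in> W11" using loc_abs_cont_lipschitz[OF w_lip] by (simp add: W11_iff w_def frac_def)
    have "area w = \<tau>"
    proof -
      have Le: "\<bar>\<tau> - area w\<bar> \<le> L * e" if e: "e > 0" for e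
      proof -
        obtain n where n: "\<And>t. dist (v (j n) t) (w t) < e"
          using uniform_limitD[OF lim e] by (auto simp: eventually_sequentially)
        show ?thesis
          using area_diff_le[OF vW v(2) w_W w_lip, of "j n" e] n v_area by (simp add: dist_norm less_imp_le)
      qed
      have "\<bar>\<tau> - area w\<bar> \<le> 0"
      proof (rule field_le_epsilon)
        fix e :: real assume e: "e > 0"
        have "\<bar>\<tau> - area w\<bar> \<le> L * (e / (L + 1))"
          by (rule Le) (use e L in simp)
        also have "\<dots> \<le> e" using e L by (simp add: field_simps)
        finally show "\<bar>\<tau> - area w\<bar> \<le> 0 + e" by simp
      qed
      then show ?thesis by simp
    qed
    then have w_M: "w \<in> Mset \<tau>" using w_W by (simp add: Mset_def)
    have "strict_mono j" using k by (simp add: strict_mono_def j_def)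
    then have "(\<lambda>n. Lagr F (v (j n))) \<longlonglongrightarrow> s" using LIMSEQ_subseq_LIMSEQ[OF v_lim] by (simp add: o_def)
    then have "Lagr F w \<le> s"
      by (intro Lagr_lower_semicontinuous[OF F_cont F_convex F_hom F_bd vW v(2) w_W w_lip lim])
    then have "Lagr F w = Sval F \<tau>" using Sval_le_Lagr[of F, OF F0 w_M] by (simp add: s_def)
    then show ?thesis using w_M w_lip by blast
  qed
  then show ?thesis using le by blast
qed

end
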